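(* Let $T>0$, $I=(0,T)$. Consider a sequence of one-dimensional vector fields $b_n\in L^\infty(I\times\mathbb{R};\mathbb{R})$, $n\in\mathbb{N}$, which are uniformly bounded, i.e. there is $C>0$ such that $|b_n|\le C$ a.e. on $I\times\mathbb{R}$ for all $n\in\mathbb{N}$. Suppose that for each $n\in\mathbb{N}$ the vector field $b_n$ is nearly incompressible with density $\rho_n$ and that there exist strictly positive constants $C_1,C_2$ such that $$C_1\le\rho_n\le C_2$$ a.e. on $I\times\mathbb{R}$ for all $n\in\mathbb{N}$. Let $X_n=X_n(t,x)$ denote the (regular Lagrangian) flow of $b_n$. Then the sequence $(X_n)_{n\in\mathbb{N}}$ is precompact in $C(K)$ for any compact $K\subset I\times\mathbb{R}$.
   Context: Nearly incompressible: $b\in L^\infty(I\times\mathbb{R};\mathbb{R})$ is called nearly incompressible with density $\rho\colon I\times\mathbb{R}\to\mathbb{R}$ if there exists $C>0$ such that $1/C\le\rho(t,x)\le C$ for a.e. $(t,x)\in I\times\mathbb{R}$ and $\partial_t\rho+\partial_x(\rho b)=0$ in the sense of distributions on $I\times\mathbb{R}$. Hamiltonian: for such $(\rho,b)$, a Hamiltonian associated with $(\rho,b)$ is a function $H$ with $\partial_xH=\rho$ and $\partial_tH=-\rho b$ in the sense of distributions on $I\times\mathbb{R}$. It is unique up to an additive constant and is chosen Lipschitz continuous on $[0,T]\times\mathbb{R}$. For every $t\in[0,T]$ the map $x\mapsto H(t,x)$ is a strictly increasing bilipschitz bijection of $\mathbb{R}$. For $(t,h)\in[0,T]\times\mathbb{R}$,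 $Y(t,h)\in\mathbb{R}$ denotes the unique number with $H(t,Y(t,h))=h$. Flow: the (regular Lagrangian) flow $X\colon[0,T]\times\mathbb{R}\to\mathbb{R}$ of a nearly incompressible $b$ is the continuous map $X(t,x):=Y(t,H(0,x))$. It does not depend on the additive constant in $H$ or on the choice of the density $\rho$. Precompact in $C(K)$ means that the restrictions to $K$ form a relatively compact set for the uniform norm (every subsequence has a further subsequence converging uniformly on $K$). *)

theory Defs
  imports "HOL-Analysis.Analysis"
begin

text \<open>A point of space-time is a pair \<open>(t, x)\<close>.  For functions that are only defined
  almost everywhere we use representatives \<open>real \<times> real \<Rightarrow> real\<close>; no definition below
  depends on their values outside the indicated domain.\<close>

definition spacetime :: "real \<Rightarrow> (real \<times> real) set" where
  "spacetime T = {0<..<T} \<times> UNIV"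

definition L_infty :: "(real \<times> real) set \<Rightarrow> (real \<times> real \<Rightarrow> real) set" where
  "L_infty \<Omega> = {f. f \<in> borel_measurable (lebesgue_on \<Omega>) \<and>
                  (\<exists>M. AE p in lebesgue_on \<Omega>. \<bar>f p\<bar> \<le> M)}"


subsection \<open>Test functions and distributions\<close>

definition partial_t :: "(real \<times> real \<Rightarrow> real) \<Rightarrow> real \<times> real \<Rightarrow> real" where
  "partial_t \<phi> = (\<lambda>(t, x). deriv (\<lambda>s. \<phi> (s, x)) t)"

definition partial_x :: "(real \<times> real \<Rightarrow> real) \<Rightarrow> real \<times> real \<Rightarrow> real" where
  "partial_x \<phi> = (\<lambda>(t, x). deriv (\<lambda>y. \<phi> (t, y)) x)"

fun C_times :: "nat \<Rightarrow> (real \<times> real \<Rightarrow> real) \<Rightarrow> bool" where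
  "C_times 0 \<phi> \<longleftrightarrow> continuous_on UNIV \<phi>"
| "C_times (Suc k) \<phi> \<longleftrightarrow>
     continuous_on UNIV \<phi> \<and>
     (\<forall>t x. (\<lambda>s. \<phi> (s, x)) field_differentiable (at t)) \<and>
     (\<forall>t x. (\<lambda>y. \<phi> (t, y)) field_differentiable (at x)) \<and>
     C_times k (partial_t \<phi>) \<and> C_times k (partial_x \<phi>)"

definition test_functions :: "(real \<times> real) set \<Rightarrow> (real \<times> real \<Rightarrow> real) set" where
  "test_functions \<Omega> = {\<phi>. (\<forall>k. C_times k \<phi>) \<and>
      compact (closure {p. \<phi> p \<noteq> 0}) \<and> closure {p. \<phi> p \<noteq> 0} \<subseteq> \<Omega>}"

text \<open>Distributions are only ever evaluated on, and compared on, test functions.\<close>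

type_synonym distribution = "(real \<times> real \<Rightarrow> real) \<Rightarrow> real"

definition regular_distr :: "(real \<times> real) set \<Rightarrow> (real \<times> real \<Rightarrow> real) \<Rightarrow> distribution" where
  "regular_distr \<Omega> u = (\<lambda>\<phi>. integral\<^sup>L (lebesgue_on \<Omega>) (\<lambda>p. u p * \<phi> p))"

definition distr_dt :: "distribution \<Rightarrow> distribution" where
  "distr_dt D = (\<lambda>\<phi>. - D (partial_t \<phi>))"

definition distr_dx :: "distribution \<Rightarrow> distribution" where
  "distr_dx D = (\<lambda>\<phi>. - D (partial_x \<phi>))"


subsection \<open>Nearly incompressible fields, Hamiltonians and flows\<close>

definition nearly_incompressible ::
    "real \<Rightarrow> (real \<times> real \<Rightarrow> real) \<Rightarrow> (real \<times> real \<Rightarrow> real) \<Rightarrow> bool" where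
  "nearly_incompressible T b \<rho> \<longleftrightarrow>
     b \<in> L_infty (spacetime T) \<and>
     \<rho> \<in> borel_measurable (lebesgue_on (spacetime T)) \<and>
     (\<exists>C>0. AE p in lebesgue_on (spacetime T). 1 / C \<le> \<rho> p \<and> \<rho> p \<le> C) \<and>
     (\<forall>\<phi>\<in>test_functions (spacetime T).
        distr_dt (regular_distr (spacetime T) \<rho>) \<phi> +
        distr_dx (regular_distr (spacetime T) (\<lambda>p. \<rho> p * b p)) \<phi> = 0)"

definition hamiltonian ::
    "real \<Rightarrow> (real \<times> real \<Rightarrow> real) \<Rightarrow> (real \<times> real \<Rightarrow> real) \<Rightarrow> (real \<times> real \<Rightarrow> real) \<Rightarrow> bool" where
  "hamiltonian T \<rho> b H \<longleftrightarrow>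
     (\<exists>L. L-lipschitz_on ({0..T} \<times> UNIV) H) \<and>
     (\<forall>\<phi>\<in>test_functions (spacetime T).
        distr_dx (regular_distr (spacetime T) H) \<phi> = regular_distr (spacetime T) \<rho> \<phi>) \<and>
     (\<forall>\<phi>\<in>test_functions (spacetime T).
        distr_dt (regular_distr (spacetime T) H) \<phi> =
        regular_distr (spacetime T) (\<lambda>p. - (\<rho> p * b p)) \<phi>)"

definition level_inverse :: "(real \<times> real \<Rightarrow> real) \<Rightarrow> real \<Rightarrow> real \<Rightarrow> real" where
  "level_inverse H t h = (THE y. H (t, y) = h)"

text \<open>The flow depends on \<open>b\<close> alone: any density of \<open>b\<close> and any associated
  Hamiltonian may be used to represent it.\<close>

definition is_flow :: "real \<Rightarrow> (real \<times> real \<Rightarrow> real) \<Rightarrow> (real \<times> real \<Rightarrow> real) \<Rightarrow> bool" where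
  "is_flow T b X \<longleftrightarrow>
     (\<exists>\<rho> H. nearly_incompressible T b \<rho> \<and> hamiltonian T \<rho> b H \<and>
        (\<forall>t\<in>{0..T}. \<forall>x. X (t, x) = level_inverse H t (H (0, x))))"


subsection \<open>Precompact sequences in \<open>C(K)\<close>\<close>

definition precompact_in_C ::
    "(real \<times> real) set \<Rightarrow> (nat \<Rightarrow> real \<times> real \<Rightarrow> real) \<Rightarrow> bool" where
  "precompact_in_C K F \<longleftrightarrow>
     (\<forall>n. continuous_on K (F n)) \<and>
     (\<forall>r. strict_mono r \<longrightarrow>
        (\<exists>s g. strict_mono (s :: nat \<Rightarrow> nat) \<and> continuous_on K g \<and>
               uniform_limit K (\<lambda>k. F (r (s k))) g sequentially))"

end

theory Submission
  imports Defs "HOL-Complex_Analysis.Great_Picard"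
begin

text \<open>
  The flows are uniformly Lipschitz on \<open>(0, T) \<times> \<real>\<close> and start from the identity, so the theorem
  is an instance of Arzela-Ascoli.  The Lipschitz bounds in time and in space have different
  reasons.

  In time the constant is \<open>C\<close>.  Let \<open>H\<close> be the Hamiltonian that represents the flow, with
  gradient \<open>(- r b, r)\<close> and \<open>r > 0\<close>.  Its derivatives in the directions \<open>(1, C)\<close> and \<open>(- 1, C)\<close>
  are \<open>r (C - b)\<close> and \<open>r (C + b)\<close>, both nonnegative, so \<open>H\<close> increases along these
  directions and a level line of \<open>H\<close> cannot leave the cone of slope \<open>C\<close> through any of its points
  (\<open>flow_time_lipschitz\<close>).  The bound does not depend on \<open>r\<close>.

  In space the constant is \<open>C\<^sub>2 / C\<^sub>1\<close>, and here the difficulty is that the uniform bounds hold for the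
  given density \<open>\<rho>\<close>, whereas \<open>H\<close> may belong to another density \<open>r\<close> of the same field.  The two are
  related by conservation of the \<open>\<rho>\<close>-mass between two level lines of \<open>H\<close>: formally, testing
  \<open>\<partial>\<^sub>t \<rho> + \<partial>\<^sub>x (\<rho> b) = 0\<close> with \<open>\<theta> (t) \<psi> (H (t, x))\<close> leaves only the term with \<open>\<theta>'\<close>, because
  \<open>\<partial>\<^sub>t H + b \<partial>\<^sub>x H = 0\<close>.  So \<open>\<integral> \<rho> (t, x) \<psi> (H (t, x)) dx\<close> is constant in time; with \<open>\<psi>\<close>
  close to the indicator of an interval of levels, and \<open>C\<^sub>1 \<le> \<rho> \<le> C\<^sub>2\<close>, the distance between
  two level lines grows at most by the factor \<open>C\<^sub>2 / C\<^sub>1\<close> from its value at time \<open>0\<close>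
  (\<open>flow_expansion\<close>).

  That test function is only Lipschitz, so \<open>H\<close> is replaced by its mollification
  \<open>H\<^sub>e\<close>.  Then \<open>\<partial>\<^sub>t H\<^sub>e + b \<partial>\<^sub>x H\<^sub>e\<close> is the commutator \<open>b (r * \<eta>\<^sub>e) - (r b) * \<eta>\<^sub>e\<close>, where
  \<open>\<eta>\<^sub>e\<close> is the mollifier; it tends to \<open>0\<close> in \<open>L\<^sup>1\<close> on bounded sets, since both terms tend to
  \<open>r b\<close> (\<open>conv_mollifier_L1\<close>).  The same mollification turns the sign of a distributional derivative
  into monotonicity of \<open>H\<close> itself (\<open>H_directional_lower\<close>).
\<close>

section \<open>A smooth step on the line\<close>

text \<open>Carrying the derivative as an existential witness, rather than iterating \<open>deriv\<close>, makes closure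
  under the algebraic operations a direct induction.\<close>

fun diff_times :: "nat \<Rightarrow> (real \<Rightarrow> real) \<Rightarrow> bool" where
  "diff_times 0 f \<longleftrightarrow> True"
| "diff_times (Suc k) f \<longleftrightarrow>
     (\<exists>f'. (\<forall>x. (f has_real_derivative f' x) (at x)) \<and> diff_times k f')"

definition smooth1 :: "(real \<Rightarrow> real) \<Rightarrow> bool" where
  "smooth1 f \<longleftrightarrow> (\<forall>k. diff_times k f)"

lemma diff_times_SucI:
  "(\<And>x. (f has_real_derivative f' x) (at x)) \<Longrightarrow> diff_times k f' \<Longrightarrow> diff_times (Suc k) f"
  by auto

lemma diff_times_Suc: "diff_times (Suc k) f \<Longrightarrow> diff_times k f"
  by (induction k arbitrary: f) (simp, metis diff_times.simps(2))

lemma diff_times_add: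
  "diff_times k f \<Longrightarrow> diff_times k g \<Longrightarrow> diff_times k (\<lambda>x. f x + g x)"
proof (induction k arbitrary: f g)
  case (Suc k)
  then obtain f' g' where "\<And>x. (f has_real_derivative f' x) (at x)" "diff_times k f'"
    "\<And>x. (g has_real_derivative g' x) (at x)" "diff_times k g'" by auto
  then show ?case
    using Suc.IH by (auto intro!: exI[of _ "\<lambda>x. f' x + g' x"] derivative_intros)
qed simp

lemma diff_times_const: "diff_times k (\<lambda>x. c)"
proof (induction k arbitrary: c)
  case (Suc k)
  then show ?case by (auto intro!: exI[of _ "\<lambda>_. 0"])
qed simp

lemma diff_times_mult:
  "diff_times k f \<Longrightarrow> diff_times k g \<Longrightarrow> diff_times k (\<lambda>x. f x * g x)"
proof (induction k arbitrary: f g)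
  case (Suc k)
  obtain f' where f: "\<And>x. (f has_real_derivative f' x) (at x)" "diff_times k f'"
    using Suc.prems(1) by auto
  obtain g' where g: "\<And>x. (g has_real_derivative g' x) (at x)" "diff_times k g'"
    using Suc.prems(2) by auto
  have "diff_times k f" "diff_times k g"
    using Suc.prems by (blast intro: diff_times_Suc)+
  then have "diff_times k (\<lambda>x. f x * g' x + f' x * g x)"
    using Suc.IH f(2) g(2) by (intro diff_times_add) auto
  moreover have "((\<lambda>x. f x * g x) has_real_derivative f x * g' x + f' x * g x) (at x)" for x
    by (rule DERIV_mult'[OF f(1) g(1)])
  ultimately show ?case by (intro diff_times_SucI)
qed simp

lemma diff_times_affine: "diff_times k f \<Longrightarrow> diff_times k (\<lambda>x. f (a * x + c))"
proof (induction k arbitrary: f)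
  case (Suc k)
  then obtain f' where f: "\<And>x. (f has_real_derivative f' x) (at x)" "diff_times k f'" by auto
  have "diff_times k (\<lambda>x. f' (a * x + c) * a)"
    using Suc.IH[OF f(2)] diff_times_const by (rule diff_times_mult)
  moreover have "((\<lambda>x. f (a * x + c)) has_real_derivative f' (a * x + c) * a) (at x)" for x
    by (rule DERIV_chain2[OF f(1)]) (auto intro!: derivative_eq_intros)
  ultimately show ?case by (intro diff_times_SucI)
qed simp

lemma smooth1_mult: "smooth1 f \<Longrightarrow> smooth1 g \<Longrightarrow> smooth1 (\<lambda>x. f x * g x)"
  and smooth1_add: "smooth1 f \<Longrightarrow> smooth1 g \<Longrightarrow> smooth1 (\<lambda>x. f x + g x)"
  and smooth1_const: "smooth1 (\<lambda>x. c)"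
  and smooth1_affine: "smooth1 f \<Longrightarrow> smooth1 (\<lambda>x. f (a * x + c))"
  unfolding smooth1_def
  by (auto intro: diff_times_mult diff_times_add diff_times_const diff_times_affine)

lemma smooth1_antiderivative:
  assumes "\<And>x. (F has_real_derivative f x) (at x)" "smooth1 f"
  shows "smooth1 F"
  unfolding smooth1_def
proof
  fix k show "diff_times k F"
    using assms by (cases k) (auto simp: smooth1_def)
qed

lemma smooth1_derivative:
  assumes "smooth1 f" "\<And>x. (f has_real_derivative f' x) (at x)"
  shows "smooth1 f'"
  unfolding smooth1_def
proof
  fix k
  have "diff_times (Suc k) f"
    using assms(1) by (simp only: smooth1_def)
  then obtain g where g: "\<And>x. (f has_real_derivative g x) (at x)" "diff_times k g"
    by auto
  have "g = f'"
    using DERIV_unique[OF g(1) assms(2)] by auto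
  with g(2) show "diff_times k f'" by simp
qed

lemma smooth1_has_derivative:
  assumes "smooth1 f"
  shows "\<exists>f'. (\<forall>x. (f has_real_derivative f' x) (at x)) \<and> smooth1 f'"
proof -
  have "diff_times (Suc 0) f"
    using assms by (simp only: smooth1_def)
  then obtain f' where "\<And>x. (f has_real_derivative f' x) (at x)" by auto
  with smooth1_derivative[OF assms] show ?thesis by blast
qed

text \<open>The functions \<open>p (1 / x) exp (- 1 / x)\<close>, cut off at the origin, form a family closed under
  differentiation; this gives smoothness of \<open>exp (- 1 / x)\<close>, the case \<open>p = 1\<close>, without computing its
  higher derivatives.\<close>

definition flat :: "real poly \<Rightarrow> real \<Rightarrow> real" where
  "flat p x = (if x > 0 then poly p (1 / x) * exp (- (1 / x)) else 0)"

lemma poly_times_exp_decay: "((\<lambda>y. poly p y * exp (- y)) \<longlongrightarrow> (0::real)) at_top"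
proof -
  have "((\<lambda>y. \<Sum>i\<le>degree p. coeff p i * (y ^ i / exp y)) \<longlongrightarrow> (\<Sum>i\<le>degree p. coeff p i * 0)) at_top"
    by (intro tendsto_intros tendsto_power_div_exp_0)
  then show ?thesis
    by (simp add: poly_altdef sum_distrib_right exp_minus divide_inverse mult.assoc)
qed

lemma flat_has_derivative:
  "(flat p has_real_derivative flat ([:0, 0, 1:] * (p - pderiv p)) x) (at x)"
proof -
  consider "x > 0" | "x < 0" | "x = 0" by linarith
  then show ?thesis
  proof cases
    case 1
    have "((\<lambda>y. poly p (1 / y) * exp (- (1 / y))) has_real_derivative
       flat ([:0, 0, 1:] * (p - pderiv p)) x) (at x)"
      using 1 by (auto intro!: derivative_eq_intros DERIV_chain2[OF poly_DERIV]
          simp: flat_def field_simps power2_eq_square)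
    moreover have "eventually (\<lambda>y. y \<in> {0<..}) (nhds x)"
      using 1 by (intro eventually_nhds_in_open) auto
    then have "eventually (\<lambda>y. flat p y = poly p (1 / y) * exp (- (1 / y))) (nhds x)"
      by eventually_elim (simp add: flat_def)
    ultimately show ?thesis
      by (subst DERIV_cong_ev[OF refl _ refl]) auto
  next
    case 2
    have "eventually (\<lambda>y. y \<in> {..<0}) (nhds x)"
      using 2 by (intro eventually_nhds_in_open) auto
    then have "eventually (\<lambda>y. flat p y = 0) (nhds x)"
      by eventually_elim (simp add: flat_def)
    then show ?thesis
      using 2 by (subst DERIV_cong_ev[OF refl _ refl]) (auto simp: flat_def)
  next
    case 3
    have "((\<lambda>y. poly (pCons 0 p) (inverse y) * exp (- inverse y)) \<longlongrightarrow> (0::real)) (at_right 0)"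
      by (rule filterlim_compose[OF poly_times_exp_decay filterlim_inverse_at_top_right])
    then have "((\<lambda>y. flat p y / y) \<longlongrightarrow> 0) (at_right 0)"
      by (rule Lim_transform_eventually)
        (auto simp: eventually_at_right_less flat_def field_simps
          intro!: eventually_mono[OF eventually_at_right_less])
    moreover have "((\<lambda>y. flat p y / y) \<longlongrightarrow> 0) (at_left 0)"
      by (rule Lim_transform_eventually[OF tendsto_const])
        (auto simp: flat_def intro!: eventually_at_leftI[of "-1"])
    ultimately have "((\<lambda>y. flat p y / y) \<longlongrightarrow> 0) (at 0)"
      using filterlim_split_at by blast
    then show ?thesis
      using 3 by (simp add: has_field_derivative_iff flat_def)
  qed
qed

lemma smooth1_flat: "smooth1 (flat p)"
  unfolding smooth1_def
proof
  fix k show "diff_times k (flat p)"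
    using flat_has_derivative by (induction k arbitrary: p) auto
qed

definition bump :: "real \<Rightarrow> real" where
  "bump x = flat 1 x * flat 1 (- 1 * x + 1)"

lemma smooth1_bump: "smooth1 bump"
  unfolding bump_def by (rule smooth1_mult[OF smooth1_flat smooth1_affine[OF smooth1_flat]])

lemma bump_nonneg: "bump x \<ge> 0"
  and bump_pos: "0 < x \<Longrightarrow> x < 1 \<Longrightarrow> bump x > 0"
  and bump_eq_0: "x \<le> 0 \<or> 1 \<le> x \<Longrightarrow> bump x = 0"
  by (auto simp: bump_def flat_def)

lemma smooth1_continuous: "smooth1 f \<Longrightarrow> continuous_on S f"
  by (meson DERIV_continuous continuous_at_imp_continuous_on smooth1_has_derivative)

definition bump_primitive :: "real \<Rightarrow> real" where
  "bump_primitive x = (LBINT y=0..x. bump y)"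

lemma bump_primitive_has_derivative: "(bump_primitive has_real_derivative bump x) (at x)"
proof -
  have "((\<lambda>u. LBINT y=0..u. bump y) has_vector_derivative bump x)
      (at x within {- \<bar>x\<bar> - 1..\<bar>x\<bar> + 1})"
    using interval_integral_FTC2[of "- \<bar>x\<bar> - 1" 0 "\<bar>x\<bar> + 1" bump x] smooth1_continuous[OF smooth1_bump]
    by (simp add: zero_ereal_def)
  then show ?thesis
    by (subst (asm) at_within_interior) 
      (auto simp: has_real_derivative_iff_has_vector_derivative bump_primitive_def[abs_def])
qed

lemma bump_primitive_mono: "x \<le> y \<Longrightarrow> bump_primitive x \<le> bump_primitive y"
  by (rule DERIV_nonneg_imp_nondecreasing) (auto intro: bump_primitive_has_derivative bump_nonneg)

lemma bump_primitive_0: "bump_primitive 0 = 0"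
  by (simp add: bump_primitive_def zero_ereal_def)

lemma bump_primitive_constant:
  assumes "x \<le> y" "\<And>z. x \<le> z \<Longrightarrow> z \<le> y \<Longrightarrow> bump z = 0"
  shows "bump_primitive x = bump_primitive y"
proof (cases "x < y")
  case True
  obtain z where "x < z" "z < y" "bump_primitive y - bump_primitive x = (y - x) * bump z"
    using MVT2[OF True bump_primitive_has_derivative] by auto
  with assms(2)[of z] show ?thesis by simp
qed (use assms in simp)

lemma bump_primitive_pos: "bump_primitive 1 > 0"
proof -
  obtain z where "0 < z" "z < (1::real)" "bump_primitive 1 - bump_primitive 0 = (1 - 0) * bump z"
    using MVT2[of 0 1, OF _ bump_primitive_has_derivative] by auto
  with bump_pos[of z] show ?thesis by (simp add: bump_primitive_0)
qed

text \<open>All cutoffs below are built from this one transition from \<open>0\<close> to \<open>1\<close> on the unit interval: its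
  derivative \<open>pulse\<close> is the one-dimensional mollifier, and differences of rescaled steps are smooth
  plateaus in time and in the level variable.\<close>

definition step :: "real \<Rightarrow> real" where "step x = bump_primitive x / bump_primitive 1"
definition pulse :: "real \<Rightarrow> real" where "pulse x = bump x / bump_primitive 1"

lemma step_has_derivative: "(step has_real_derivative pulse x) (at x)"
  using DERIV_cdivide[OF bump_primitive_has_derivative] by (simp add: step_def[abs_def] pulse_def)

lemma smooth1_pulse: "smooth1 pulse"
  unfolding pulse_def divide_inverse by (intro smooth1_mult smooth1_bump smooth1_const)

lemma smooth1_step: "smooth1 step"
  by (rule smooth1_antiderivative[OF step_has_derivative smooth1_pulse])

lemma pulse_nonneg: "pulse x \<ge> 0"
  using bump_primitive_pos by (simp add: pulse_def bump_nonneg)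

lemma pulse_eq_0: "x \<le> 0 \<or> 1 \<le> x \<Longrightarrow> pulse x = 0"
  by (simp add: pulse_def bump_eq_0)

lemma step_eq_0: "x \<le> 0 \<Longrightarrow> step x = 0"
  using bump_primitive_constant[of x 0] by (simp add: step_def bump_eq_0 bump_primitive_0)

lemma step_eq_1: "1 \<le> x \<Longrightarrow> step x = 1"
  using bump_primitive_constant[of 1 x] bump_primitive_pos by (simp add: step_def bump_eq_0)

lemma step_mono: "x \<le> y \<Longrightarrow> step x \<le> step y"
  using bump_primitive_mono bump_primitive_pos by (simp add: step_def divide_right_mono)

lemma step_bounds: "0 \<le> step x" "step x \<le> 1"
  using step_mono[of 0 "max 0 x"] step_mono[of x "max 1 x"] step_mono[of "min 0 x" x]
    step_eq_0[of 0] step_eq_0[of "min 0 x"] step_eq_1[of "max 1 x"] by auto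

lemma has_bochner_integral_pulse: "has_bochner_integral lborel pulse 1"
proof -
  have c: "continuous_on UNIV pulse"
    by (rule smooth1_continuous[OF smooth1_pulse])
  have "has_bochner_integral lborel (\<lambda>s. pulse s * indicator {0..1} s) (step 1 - step 0)"
    using c by (intro has_bochner_integral_FTC_Icc_nonneg DERIV_subset[OF step_has_derivative] step_has_derivative)
      (simp_all add: pulse_nonneg continuous_on_eq_continuous_at borel_measurable_continuous_onI)
  moreover have "pulse s * indicator {0..1} s = pulse s" for s
    using pulse_eq_0[of s] by (cases "0 \<le> s \<and> s \<le> 1") auto
  ultimately show ?thesis
    by (simp add: step_eq_0 step_eq_1)
qed

lemma nn_integral_pulse_affine:
  assumes "c \<noteq> 0"
  shows "(\<integral>\<^sup>+s. ennreal (pulse (t + c * s) * \<bar>c\<bar>) \<partial>lborel) = 1"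
proof -
  have "has_bochner_integral lborel (\<lambda>s. pulse (t + c * s)) (1 /\<^sub>R \<bar>c\<bar>)"
    using has_bochner_integral_pulse lborel_has_bochner_integral_real_affine_iff[OF assms, of pulse 1 t] by simp
  then have "has_bochner_integral lborel (\<lambda>s. pulse (t + c * s) * \<bar>c\<bar>) (1 /\<^sub>R \<bar>c\<bar> * \<bar>c\<bar>)"
    by (rule has_bochner_integral_mult_left)
  then show ?thesis
    using assms pulse_nonneg
    by (subst nn_integral_eq_integral) (auto simp: has_bochner_integral_iff)
qed

section \<open>Calculus of smooth functions on the plane\<close>

lemma C_times_Suc: "C_times (Suc k) \<phi> \<Longrightarrow> C_times k \<phi>"
proof (induction k arbitrary: \<phi>)
  case (Suc k)
  note C = Suc.prems[unfolded C_times.simps(2)[of "Suc k" \<phi>]]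
  then have "C_times k (partial_t \<phi>)" "C_times k (partial_x \<phi>)"
    by (blast intro: Suc.IH)+
  with C show ?case
    unfolding C_times.simps(2)[of k \<phi>] by blast
qed simp

lemma C_times_continuous: "C_times k \<phi> \<Longrightarrow> continuous_on UNIV \<phi>"
  by (cases k) auto

text \<open>Together with \<open>C_times_SucD\<close> this replaces the partial derivatives, which are defined through
  \<open>deriv\<close>, by derivative judgements to which the usual rules apply.\<close>

lemma C_times_SucI:
  assumes "continuous_on UNIV f"
    and "\<And>t x. ((\<lambda>s. f (s, x)) has_real_derivative ft (t, x)) (at t)"
    and "\<And>t x. ((\<lambda>y. f (t, y)) has_real_derivative fx (t, x)) (at x)"
    and "C_times k ft" "C_times k fx"
  shows "C_times (Suc k) f"
proof -
  have "partial_t f = ft" "partial_x f = fx"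
    using assms(2,3) by (auto simp: partial_t_def partial_x_def fun_eq_iff intro: DERIV_imp_deriv)
  with assms show ?thesis
    by (simp add: field_differentiable_def) blast
qed

lemma C_times_SucD:
  assumes "C_times (Suc k) f"
  shows "((\<lambda>s. f (s, x)) has_real_derivative partial_t f (t, x)) (at t)"
    and "((\<lambda>y. f (t, y)) has_real_derivative partial_x f (t, x)) (at x)"
    and "C_times k (partial_t f)" "C_times k (partial_x f)" "C_times k f"
  using assms C_times_Suc[OF assms]
  by (auto simp: partial_t_def partial_x_def field_differentiable_derivI)

lemma C_times_const: "C_times k (\<lambda>p. c)"
proof (induction k arbitrary: c)
  case (Suc k)
  show ?case
    by (rule C_times_SucI[of _ "\<lambda>_. 0" "\<lambda>_. 0"]) (auto intro: Suc)
qed simp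

lemma C_times_fst: "C_times k fst" and C_times_snd: "C_times k snd"
proof -
  show "C_times k fst"
  proof (cases k)
    case (Suc j)
    show ?thesis unfolding Suc
      by (rule C_times_SucI[of _ "\<lambda>_. 1" "\<lambda>_. 0"]) (auto intro!: C_times_const continuous_on_fst continuous_on_snd)
  qed (simp add: continuous_on_fst continuous_on_snd)
  show "C_times k snd"
  proof (cases k)
    case (Suc j)
    show ?thesis unfolding Suc
      by (rule C_times_SucI[of _ "\<lambda>_. 0" "\<lambda>_. 1"]) (auto intro!: C_times_const continuous_on_fst continuous_on_snd)
  qed (simp add: continuous_on_fst continuous_on_snd)
qed

lemma C_times_add: "C_times k f \<Longrightarrow> C_times k g \<Longrightarrow> C_times k (\<lambda>p. f p + g p)"
proof (induction k arbitrary: f g)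
  case (Suc k)
  note f = C_times_SucD[OF Suc.prems(1)] and g = C_times_SucD[OF Suc.prems(2)]
  show ?case
    by (rule C_times_SucI[OF _ DERIV_add[OF f(1) g(1)] DERIV_add[OF f(2) g(2)]
          Suc.IH[OF f(3) g(3)] Suc.IH[OF f(4) g(4)]])
      (intro continuous_on_add C_times_continuous[OF Suc.prems(1)] C_times_continuous[OF Suc.prems(2)])
qed (simp add: continuous_on_add)

lemma C_times_mult: "C_times k f \<Longrightarrow> C_times k g \<Longrightarrow> C_times k (\<lambda>p. f p * g p)"
proof (induction k arbitrary: f g)
  case (Suc k)
  note f = C_times_SucD[OF Suc.prems(1)] and g = C_times_SucD[OF Suc.prems(2)]
  have *: "C_times k (\<lambda>p. f p * partial_t g p + partial_t f p * g p)"
    "C_times k (\<lambda>p. f p * partial_x g p + partial_x f p * g p)"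
    by (intro C_times_add Suc.IH f g)+
  show ?case
    by (rule C_times_SucI[OF _ DERIV_mult'[OF f(1) g(1)] DERIV_mult'[OF f(2) g(2)] *])
      (intro continuous_on_mult C_times_continuous[OF Suc.prems(1)] C_times_continuous[OF Suc.prems(2)])
qed (simp add: continuous_on_mult)

lemma C_times_compose: "smooth1 h \<Longrightarrow> C_times k g \<Longrightarrow> C_times k (\<lambda>p. h (g p))"
proof (induction k arbitrary: h g)
  case 0
  then show ?case
    using continuous_on_compose2[OF smooth1_continuous[OF 0(1), of UNIV] C_times_continuous[OF 0(2)] subset_UNIV]
    by simp
next
  case (Suc k)
  note g = C_times_SucD[OF Suc.prems(2)]
  obtain h' where h: "\<And>x. (h has_real_derivative h' x) (at x)" "smooth1 h'"
    using smooth1_has_derivative[OF Suc.prems(1)] by blast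
  have *: "C_times k (\<lambda>p. h' (g p) * partial_t g p)" "C_times k (\<lambda>p. h' (g p) * partial_x g p)"
    by (intro C_times_mult Suc.IH[OF h(2) g(5)] g(3,4))+
  show ?case
  proof (rule C_times_SucI[OF _ _ _ *])
    show "continuous_on UNIV (\<lambda>p. h (g p))"
      by (rule continuous_on_compose2[OF smooth1_continuous[OF Suc.prems(1), of UNIV]
            C_times_continuous[OF Suc.prems(2)] subset_UNIV])
    show "((\<lambda>s. h (g (s, x))) has_real_derivative h' (g (t, x)) * partial_t g (t, x)) (at t)"
      "((\<lambda>y. h (g (t, y))) has_real_derivative h' (g (t, x)) * partial_x g (t, x)) (at x)" for t x
      by (rule DERIV_chain2[OF h(1) g(1)], rule DERIV_chain2[OF h(1) g(2)])
  qed
qed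

lemma C_times_translate_reflect: "C_times k \<phi> \<Longrightarrow> C_times k (\<lambda>p. \<phi> (q - p))"
  and partial_translate_reflect:
    "C_times (Suc 0) \<phi> \<Longrightarrow> partial_t (\<lambda>p. \<phi> (q - p)) = (\<lambda>p. - partial_t \<phi> (q - p))"
    "C_times (Suc 0) \<phi> \<Longrightarrow> partial_x (\<lambda>p. \<phi> (q - p)) = (\<lambda>p. - partial_x \<phi> (q - p))"
proof -
  obtain t0 x0 where q: "q = (t0, x0)" by (cases q)
  have D: "((\<lambda>s. \<phi> (q - (s, x))) has_real_derivative - partial_t \<phi> (q - (t, x))) (at t)"
    "((\<lambda>y. \<phi> (q - (t, y))) has_real_derivative - partial_x \<phi> (q - (t, x))) (at x)"
    if "C_times (Suc k) \<phi>" for t x k and \<phi> :: "real \<times> real \<Rightarrow> real"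
  proof -
    have a: "((\<lambda>s. t0 - s) has_real_derivative - 1) (at t)"
      "((\<lambda>s. x0 - s) has_real_derivative - 1) (at x)"
      by (auto intro!: derivative_eq_intros)
    show "((\<lambda>s. \<phi> (q - (s, x))) has_real_derivative - partial_t \<phi> (q - (t, x))) (at t)"
      using DERIV_chain2[OF C_times_SucD(1)[OF that] a(1)] by (simp add: q)
    show "((\<lambda>y. \<phi> (q - (t, y))) has_real_derivative - partial_x \<phi> (q - (t, x))) (at x)"
      using DERIV_chain2[OF C_times_SucD(2)[OF that] a(2)] by (simp add: q)
  qed
  have c: "continuous_on UNIV (\<lambda>p. \<phi> (q - p))" if "continuous_on UNIV \<phi>" for \<phi> :: "real \<times> real \<Rightarrow> real"
    by (rule continuous_on_compose2[OF that]) (auto intro!: continuous_on_diff continuous_on_id)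
  show "C_times k \<phi> \<Longrightarrow> C_times k (\<lambda>p. \<phi> (q - p))"
  proof (induction k arbitrary: \<phi>)
    case 0
    then show ?case using c[of \<phi>] by simp
  next
    case (Suc k)
    have neg: "C_times k (\<lambda>p. - 1 * f (q - p))" if "C_times k f" for f
      by (intro C_times_mult C_times_const Suc.IH that)
    note C = C_times_SucD[OF Suc.prems]
    show ?case
      by (rule C_times_SucI[OF c[OF C_times_continuous[OF Suc.prems]] D[OF Suc.prems]])
        (use neg[OF C(3)] neg[OF C(4)] in simp_all)
  qed
  show "C_times (Suc 0) \<phi> \<Longrightarrow> partial_t (\<lambda>p. \<phi> (q - p)) = (\<lambda>p. - partial_t \<phi> (q - p))"
    by (auto simp: partial_t_def[of "\<lambda>p. \<phi> (q - p)"] fun_eq_iff simp del: C_times.simps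
        intro!: DERIV_imp_deriv D(1))
  show "C_times (Suc 0) \<phi> \<Longrightarrow> partial_x (\<lambda>p. \<phi> (q - p)) = (\<lambda>p. - partial_x \<phi> (q - p))"
    by (auto simp: partial_x_def[of "\<lambda>p. \<phi> (q - p)"] fun_eq_iff simp del: C_times.simps
        intro!: DERIV_imp_deriv D(2))
qed

text \<open>Smoothness is formulated through partial derivatives, whereas the transport estimates
  differentiate along oblique lines.  Continuity of the partial derivatives provides the total
  derivative.\<close>

lemma C_times_directional_derivative:
  assumes "C_times (Suc 0) f"
  shows "((\<lambda>s. f (t + s * \<alpha>, x + s * \<beta>)) has_real_derivative
     \<alpha> * partial_t f (t + s * \<alpha>, x + s * \<beta>) + \<beta> * partial_x f (t + s * \<alpha>, x + s * \<beta>)) (at s)"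
proof -
  note D = C_times_SucD[OF assms]
  let ?t = "t + s * \<alpha>" and ?x = "x + s * \<beta>"
  let ?g = "\<lambda>t' x'. f (t', x')"
  have cont: "continuous (at (?t, ?x) within UNIV \<times> UNIV) (\<lambda>(t', x'). blinfun_scaleR_left (partial_x f (t', x')))"
  proof -
    have "isCont (partial_x f) (?t, ?x)"
      using C_times_continuous[OF D(4)] by (simp add: continuous_on_eq_continuous_at)
    then have "isCont (\<lambda>p. blinfun_scaleR_left (partial_x f p)) (?t, ?x)"
      by (rule bounded_linear.isCont[OF bounded_linear_blinfun_scaleR_left])
    then show ?thesis by (simp add: split_def)
  qed
  have "((\<lambda>(t', x'). ?g t' x') has_derivative
      (\<lambda>(tx, ty). partial_t f (?t, ?x) * tx + blinfun_scaleR_left (partial_x f (?t, ?x)) ty))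
      (at (?t, ?x) within UNIV \<times> UNIV)"
  proof (rule has_derivative_partialsI[OF _ _ cont])
    show "((\<lambda>t'. f (t', ?x)) has_derivative (\<lambda>tx. partial_t f (?t, ?x) * tx)) (at ?t)"
      using D(1)[of ?x ?t] by (simp add: has_field_derivative_def)
    show "((\<lambda>x'. f (t', x')) has_derivative blinfun_apply (blinfun_scaleR_left (partial_x f (t', x')))) (at x')"
      for t' x'
      using D(2)[of t' x'] unfolding has_field_derivative_def
      by (rule has_derivative_eq_rhs) (simp add: fun_eq_iff)
  qed auto
  then have g: "(f has_derivative (\<lambda>h. partial_t f (?t, ?x) * fst h + snd h * partial_x f (?t, ?x))) (at (?t, ?x))"
    by (simp add: split_def)
  have "((\<lambda>s. (t + s * \<alpha>, x + s * \<beta>)) has_derivative (\<lambda>h. (h * \<alpha>, h * \<beta>))) (at s)"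
    by (auto intro!: derivative_eq_intros)
  from has_derivative_compose[OF this g] show ?thesis
    unfolding has_field_derivative_def
    by (rule has_derivative_eq_rhs) (simp add: fun_eq_iff algebra_simps)
qed

section \<open>Test functions\<close>

text \<open>Vanishing outside some compact set is easier to check than a condition on the closed
  support.\<close>

lemma test_functionsI:
  assumes "\<And>k. C_times k \<phi>" "compact K" "K \<subseteq> \<Omega>" "\<And>p. p \<notin> K \<Longrightarrow> \<phi> p = 0"
  shows "\<phi> \<in> test_functions \<Omega>"
proof -
  have "{p. \<phi> p \<noteq> 0} \<subseteq> K" using assms(4) by auto
  then have "closure {p. \<phi> p \<noteq> 0} \<subseteq> K"
    using assms(2) by (simp add: closure_minimal compact_imp_closed)
  moreover from this have "compact (closure {p. \<phi> p \<noteq> 0})"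
    using assms(2) bounded_subset by (auto simp: compact_eq_bounded_closed)
  ultimately show ?thesis
    using assms(1,3) by (auto simp: test_functions_def)
qed

lemma test_functionsD:
  assumes "\<phi> \<in> test_functions \<Omega>"
  shows "C_times k \<phi>" "compact (closure {p. \<phi> p \<noteq> 0})" "closure {p. \<phi> p \<noteq> 0} \<subseteq> \<Omega>"
  using assms by (auto simp: test_functions_def)

lemma partial_eq_0:
  assumes "p \<notin> closure {p. \<phi> p \<noteq> 0}"
  shows "partial_t \<phi> p = 0" "partial_x \<phi> p = 0"
proof -
  obtain t x where p: "p = (t, x)" by (cases p)
  let ?U = "- closure {p. \<phi> p \<noteq> 0}"
  have zero: "\<phi> p = 0" if "p \<in> ?U" for p
    using that closure_subset[of "{p. \<phi> p \<noteq> 0}"] by auto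
  have c: "continuous_on UNIV (\<lambda>s. (s, x))" "continuous_on UNIV (\<lambda>y. (t, y))"
    by (intro continuous_intros)+
  have op: "open ((\<lambda>s. (s, x)) -` ?U)" "open ((\<lambda>y. (t, y)) -` ?U)"
    using c by (auto intro!: open_vimage)
  have "eventually (\<lambda>s. s \<in> (\<lambda>s. (s, x)) -` ?U) (nhds t)"
    by (rule eventually_nhds_in_open[OF op(1)]) (use assms p in simp)
  then have "eventually (\<lambda>s. \<phi> (s, x) = 0) (nhds t)"
    by (rule eventually_mono) (rule zero, simp)
  then show "partial_t \<phi> p = 0"
    unfolding p partial_t_def prod.case by (subst deriv_cong_ev[where g = "\<lambda>_. 0"]) auto
  have "eventually (\<lambda>y. y \<in> (\<lambda>y. (t, y)) -` ?U) (nhds x)"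
    by (rule eventually_nhds_in_open[OF op(2)]) (use assms p in simp)
  then have "eventually (\<lambda>y. \<phi> (t, y) = 0) (nhds x)"
    by (rule eventually_mono) (rule zero, simp)
  then show "partial_x \<phi> p = 0"
    unfolding p partial_x_def prod.case by (subst deriv_cong_ev[where g = "\<lambda>_. 0"]) auto
qed

lemma test_functions_partial:
  assumes "\<phi> \<in> test_functions \<Omega>"
  shows "partial_t \<phi> \<in> test_functions \<Omega>" "partial_x \<phi> \<in> test_functions \<Omega>"
  using test_functionsD[OF assms] partial_eq_0[of _ \<phi>] C_times_SucD(3,4)[OF test_functionsD(1)[OF assms]]
  by (auto intro!: test_functionsI[where K = "closure {p. \<phi> p \<noteq> 0}"])

lemma test_functions_bounds:
  assumes "\<phi> \<in> test_functions \<Omega>"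
  obtains B R where "\<And>p. \<bar>\<phi> p\<bar> \<le> B" "0 \<le> B" "\<And>p. R < norm p \<Longrightarrow> \<phi> p = 0" "0 \<le> R"
proof -
  let ?K = "closure {p. \<phi> p \<noteq> 0}"
  note \<phi> = test_functionsD[OF assms]
  have "continuous_on ?K \<phi>"
    using C_times_continuous[OF \<phi>(1)[of 0]] continuous_on_subset by blast
  then have "bounded (\<phi> ` ?K)"
    using \<phi>(2) compact_continuous_image compact_imp_bounded by blast
  then obtain B where B: "\<And>p. p \<in> ?K \<Longrightarrow> \<bar>\<phi> p\<bar> \<le> B"
    by (auto simp: bounded_iff)
  obtain R where R: "\<And>p. p \<in> ?K \<Longrightarrow> norm p \<le> R"
    using compact_imp_bounded[OF \<phi>(2)] by (auto simp: bounded_iff)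
  have zero: "\<phi> p = 0" if "p \<notin> ?K" for p
    using that closure_subset[of "{p. \<phi> p \<noteq> 0}"] by auto
  show thesis
  proof (rule that[of "max B 0" "max R 0"])
    show "\<bar>\<phi> p\<bar> \<le> max B 0" for p
      using B[of p] zero[of p] by (cases "p \<in> ?K") auto
    show "max R 0 < norm p \<Longrightarrow> \<phi> p = 0" for p
      using R[of p] zero[of p] by (cases "p \<in> ?K") auto
  qed auto
qed

lemma test_functions_continuous: "\<phi> \<in> test_functions \<Omega> \<Longrightarrow> continuous_on UNIV \<phi>"
  using C_times_continuous test_functionsD(1) by blast

section \<open>Convolution with a test function\<close>

text \<open>A Hamiltonian grows linearly in space, so global integrability is not available; local boundedness
  suffices against compactly supported kernels.\<close>

definition locally_bounded_borel :: "(real \<times> real \<Rightarrow> real) \<Rightarrow> bool" where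
  "locally_bounded_borel w \<longleftrightarrow>
     w \<in> borel_measurable borel \<and> (\<forall>R. \<exists>M. \<forall>p\<in>cball 0 R. \<bar>w p\<bar> \<le> M)"

lemma locally_bounded_borelI:
  assumes "w \<in> borel_measurable borel" "\<And>p. \<bar>w p\<bar> \<le> B"
  shows "locally_bounded_borel w"
  using assms unfolding locally_bounded_borel_def by blast

lemma locally_bounded_borel_integrable:
  assumes w: "locally_bounded_borel w" and f: "f \<in> borel_measurable borel"
    and B: "\<And>p. norm p \<le> R \<Longrightarrow> \<bar>f p\<bar> \<le> B" and R: "\<And>p. R < norm p \<Longrightarrow> f p = 0"
  shows "integrable lborel (\<lambda>p. w p * f p)"
proof -
  obtain M where M: "\<And>p. p \<in> cball 0 R \<Longrightarrow> \<bar>w p\<bar> \<le> M"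
    using w unfolding locally_bounded_borel_def by blast
  have [measurable]: "w \<in> borel_measurable borel" "f \<in> borel_measurable borel"
    using w f by (auto simp: locally_bounded_borel_def)
  show ?thesis
  proof (rule integrableI_bounded_set[where A = "cball 0 R" and B = "M * B"])
    show "emeasure lborel (cball (0 :: real \<times> real) R) < \<infinity>"
      using emeasure_bounded_finite[OF bounded_cball] by simp
    have "\<bar>w p\<bar> * \<bar>f p\<bar> \<le> M * B" if "norm p \<le> R" for p
      using M[of p] B[of p] that by (intro mult_mono) auto
    then show "AE p in lborel. p \<in> cball 0 R \<longrightarrow> norm (w p * f p) \<le> M * B"
      by (auto simp: abs_mult)
    show "AE p in lborel. p \<notin> cball 0 R \<longrightarrow> w p * f p = 0"
      using R by auto
  qed simp_all
qed

text \<open>Differentiation under the integral.  The difference quotients are dominated by the bound on the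
  derivative of the kernel, restricted to a ball that contains the supports of the kernel for all
  parameters near \<open>t\<close>.\<close>

lemma has_derivative_integral_parameter:
  fixes k k' :: "real \<Rightarrow> real \<times> real \<Rightarrow> real"
  assumes w: "locally_bounded_borel w"
    and k: "\<And>s. k s \<in> borel_measurable borel" and k': "k' t \<in> borel_measurable borel"
    and deriv: "\<And>s p. ((\<lambda>s. k s p) has_real_derivative k' s p) (at s)"
    and B: "\<And>s p. \<bar>k' s p\<bar> \<le> B"
    and R: "\<And>s p. \<bar>s - t\<bar> \<le> 1 \<Longrightarrow> R < norm p \<Longrightarrow> k s p = 0"
    and C: "\<And>s p. \<bar>k s p\<bar> \<le> C"
  shows "((\<lambda>s. \<integral>p. w p * k s p \<partial>lborel) has_real_derivative (\<integral>p. w p * k' t p \<partial>lborel)) (at t)"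
proof -
  let ?F = "\<lambda>s. \<integral>p. w p * k s p \<partial>lborel"
  have [measurable]: "w \<in> borel_measurable borel" "k s \<in> borel_measurable borel"
    "k' t \<in> borel_measurable borel" for s
    using w k k' by (auto simp: locally_bounded_borel_def)
  have Lip: "\<bar>k s p - k t p\<bar> \<le> B * \<bar>s - t\<bar>" for s p
    using field_differentiable_bound[of UNIV "\<lambda>s. k s p" "\<lambda>s. k' s p" B s t] deriv B by auto
  have int: "integrable lborel (\<lambda>p. w p * k s p)" if "\<bar>s - t\<bar> \<le> 1" for s
    using R[OF that] C by (intro locally_bounded_borel_integrable[OF w k]) auto
  have "((\<lambda>s. (?F s - ?F t) / (s - t)) \<longlongrightarrow> (\<integral>p. w p * k' t p \<partial>lborel)) (at t within {t - 1<..<t + 1})"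
    unfolding tendsto_at_iff_sequentially comp_def
  proof safe
    fix X assume X: "\<forall>i. X i \<in> {t - 1<..<t + 1} - {t}" "X \<longlonglongrightarrow> t"
    have Xt: "\<bar>X i - t\<bar> \<le> 1" "X i \<noteq> t" for i
      using X(1)[rule_format, of i] by auto
    have "(\<lambda>i. \<integral>p. w p * ((k (X i) p - k t p) / (X i - t)) \<partial>lborel) \<longlonglongrightarrow> (\<integral>p. w p * k' t p \<partial>lborel)"
    proof (rule integral_dominated_convergence[where w = "\<lambda>p. \<bar>w p * (B * indicator (cball 0 R) p)\<bar>"])
      show "integrable lborel (\<lambda>p. \<bar>w p * (B * indicator (cball 0 R) p)\<bar>)"
        by (intro integrable_abs locally_bounded_borel_integrable[OF w, where B = "\<bar>B\<bar>" and R = R])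
          (auto simp: indicator_def)
      show "AE p in lborel. (\<lambda>i. w p * ((k (X i) p - k t p) / (X i - t))) \<longlonglongrightarrow> w p * k' t p"
      proof (intro always_eventually allI tendsto_mult tendsto_const)
        fix p
        have "((\<lambda>s. (k s p - k t p) / (s - t)) \<longlongrightarrow> k' t p) (at t)"
          using deriv[of p t] by (simp add: has_field_derivative_iff)
        moreover have "filterlim X (at t) sequentially"
          using X(2) Xt(2) by (auto simp: filterlim_at)
        ultimately show "(\<lambda>i. (k (X i) p - k t p) / (X i - t)) \<longlonglongrightarrow> k' t p"
          by (rule filterlim_compose)
      qed
      have "\<bar>(k (X i) p - k t p) / (X i - t)\<bar> \<le> \<bar>B * indicator (cball 0 R) p\<bar>" for i p
      proof (cases "norm p \<le> R")
        case True
        have "\<bar>(k (X i) p - k t p) / (X i - t)\<bar> \<le> B"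
          using Lip[of "X i" p] Xt(2)[of i] by (simp add: abs_divide divide_le_eq)
        with True show ?thesis by (auto simp: indicator_def)
      next
        case False
        with R[of _ p] Xt(1)[of i] show ?thesis by (auto simp: indicator_def)
      qed
      then show "AE p in lborel. norm (w p * ((k (X i) p - k t p) / (X i - t)))
          \<le> \<bar>w p * (B * indicator (cball 0 R) p)\<bar>" for i
        unfolding real_norm_def abs_mult[of "w _"] by (intro always_eventually allI mult_left_mono) simp_all
    qed simp_all
    moreover have "(\<integral>p. w p * ((k (X i) p - k t p) / (X i - t)) \<partial>lborel) = (?F (X i) - ?F t) / (X i - t)" for i
    proof -
      have "(\<integral>p. w p * k (X i) p - w p * k t p \<partial>lborel) = ?F (X i) - ?F t"
        using Xt(1) by (intro Bochner_Integration.integral_diff int) auto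
      moreover have "(\<lambda>p. w p * ((k (X i) p - k t p) / (X i - t)))
          = (\<lambda>p. (w p * k (X i) p - w p * k t p) / (X i - t))"
        by (simp add: right_diff_distrib)
      ultimately show ?thesis by simp
    qed
    ultimately show "(\<lambda>i. (?F (X i) - ?F t) / (X i - t)) \<longlonglongrightarrow> (\<integral>p. w p * k' t p \<partial>lborel)"
      by (simp only:)
  qed
  then show ?thesis
    by (subst (asm) at_within_open) (auto simp: has_field_derivative_iff)
qed

definition conv :: "(real \<times> real \<Rightarrow> real) \<Rightarrow> (real \<times> real \<Rightarrow> real) \<Rightarrow> real \<times> real \<Rightarrow> real" where
  "conv w \<phi> q = (\<integral>p. w p * \<phi> (q - p) \<partial>lborel)"

lemma conv_integrable:
  assumes w: "locally_bounded_borel w" and \<phi>: "\<phi> \<in> test_functions \<Omega>"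
  shows "integrable lborel (\<lambda>p. w p * \<phi> (q - p))"
proof -
  obtain B R where B: "\<And>p. \<bar>\<phi> p\<bar> \<le> B" and R: "\<And>p. R < norm p \<Longrightarrow> \<phi> p = 0"
    using test_functions_bounds[OF \<phi>] by metis
  have [measurable]: "\<phi> \<in> borel_measurable borel"
    using test_functions_continuous[OF \<phi>] by (rule borel_measurable_continuous_onI)
  show ?thesis
  proof (rule locally_bounded_borel_integrable[OF w, where R = "norm q + R" and B = B])
    show "norm q + R < norm p \<Longrightarrow> \<phi> (q - p) = 0" for p
      using norm_triangle_ineq2[of p q] by (intro R) (simp add: norm_minus_commute)
  qed (use B in auto)
qed

lemma conv_continuous:
  assumes w: "locally_bounded_borel w" and \<phi>: "\<phi> \<in> test_functions \<Omega>"
  shows "continuous_on UNIV (conv w \<phi>)"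
proof -
  obtain B R where B: "\<And>p. \<bar>\<phi> p\<bar> \<le> B" and R: "\<And>p. R < norm p \<Longrightarrow> \<phi> p = 0"
    using test_functions_bounds[OF \<phi>] by metis
  have [measurable]: "\<phi> \<in> borel_measurable borel" "w \<in> borel_measurable borel"
    using test_functions_continuous[OF \<phi>] w
    by (auto simp: locally_bounded_borel_def intro: borel_measurable_continuous_onI)
  show ?thesis
    unfolding continuous_on_sequentially comp_def
  proof safe
    fix X :: "nat \<Rightarrow> real \<times> real" and a b :: real assume X: "X \<longlonglongrightarrow> (a, b)"
    define q where "q = (a, b)"
    obtain Q where Q: "\<And>i. norm (X i) \<le> Q"
      using Bseq_def convergent_imp_Bseq X by (metis convergentI)
    have "(\<lambda>i. \<integral>p. w p * \<phi> (X i - p) \<partial>lborel) \<longlonglongrightarrow> (\<integral>p. w p * \<phi> (q - p) \<partial>lborel)"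
    proof (rule integral_dominated_convergence[where w = "\<lambda>p. \<bar>w p * (B * indicator (cball 0 (Q + R)) p)\<bar>"])
      show "integrable lborel (\<lambda>p. \<bar>w p * (B * indicator (cball 0 (Q + R)) p)\<bar>)"
        by (intro integrable_abs locally_bounded_borel_integrable[OF w, where B = "\<bar>B\<bar>" and R = "Q + R"])
          (auto simp: indicator_def)
      have "(\<lambda>i. \<phi> (X i - p)) \<longlonglongrightarrow> \<phi> (q - p)" for p
        using X unfolding q_def
        by (intro continuous_on_tendsto_compose[OF test_functions_continuous[OF \<phi>]] tendsto_intros) auto
      then show "AE p in lborel. (\<lambda>i. w p * \<phi> (X i - p)) \<longlonglongrightarrow> w p * \<phi> (q - p)"
        by (intro always_eventually allI tendsto_mult tendsto_const)
      have "\<bar>\<phi> (X i - p)\<bar> \<le> \<bar>B * indicator (cball 0 (Q + R)) p\<bar>" for i p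
      proof (cases "norm p \<le> Q + R")
        case True
        then show ?thesis using B[of "X i - p"] by (auto simp: indicator_def)
      next
        case False
        then have "R < norm (X i - p)"
          using norm_triangle_ineq2[of p "X i"] Q[of i] by (simp add: norm_minus_commute)
        then show ?thesis by (simp add: R)
      qed
      then show "AE p in lborel. norm (w p * \<phi> (X i - p)) \<le> \<bar>w p * (B * indicator (cball 0 (Q + R)) p)\<bar>" for i
        unfolding real_norm_def abs_mult[of "w _"] by (intro always_eventually allI mult_left_mono) simp_all
    qed simp_all
    then show "(\<lambda>i. conv w \<phi> (X i)) \<longlonglongrightarrow> conv w \<phi> (a, b)"
      by (simp add: conv_def q_def)
  qed
qed

lemma conv_has_derivative:
  assumes w: "locally_bounded_borel w" and \<phi>: "\<phi> \<in> test_functions \<Omega>"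
  shows "((\<lambda>s. conv w \<phi> (s, x)) has_real_derivative conv w (partial_t \<phi>) (t, x)) (at t)"
    and "((\<lambda>y. conv w \<phi> (t, y)) has_real_derivative conv w (partial_x \<phi>) (t, x)) (at x)"
proof -
  obtain C R where C: "\<And>p. \<bar>\<phi> p\<bar> \<le> C" and R: "\<And>p. R < norm p \<Longrightarrow> \<phi> p = 0"
    using test_functions_bounds[OF \<phi>] by metis
  obtain Bt where Bt: "\<And>p. \<bar>partial_t \<phi> p\<bar> \<le> Bt"
    using test_functions_bounds[OF test_functions_partial(1)[OF \<phi>]] by metis
  obtain Bx where Bx: "\<And>p. \<bar>partial_x \<phi> p\<bar> \<le> Bx"
    using test_functions_bounds[OF test_functions_partial(2)[OF \<phi>]] by metis
  have [measurable]: "\<phi> \<in> borel_measurable borel" "partial_t \<phi> \<in> borel_measurable borel"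
    "partial_x \<phi> \<in> borel_measurable borel"
    using \<phi> test_functions_partial[OF \<phi>]
    by (auto intro!: borel_measurable_continuous_onI test_functions_continuous)
  note D = C_times_SucD(1,2)[OF test_functionsD(1)[OF \<phi>]]
  have far: "\<phi> (q' - p) = 0" if "norm (q' - q) \<le> 1" "norm q + 1 + R < norm p" for q q' p :: "real \<times> real"
    using that norm_triangle_ineq2[of p q'] norm_triangle_ineq2[of q' q]
    by (intro R) (simp add: norm_minus_commute)
  have n: "norm ((s, x) - (t, x)) = \<bar>s - t\<bar>" "norm ((t, y) - (t, x)) = \<bar>y - x\<bar>" for s y
    by (simp_all add: norm_Pair)
  have Dt: "((\<lambda>s. \<phi> ((s, x) - p)) has_real_derivative partial_t \<phi> ((s, x) - p)) (at s)" for s p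
    using DERIV_shift[of "\<lambda>s. \<phi> (s, x - snd p)" "partial_t \<phi> (s - fst p, x - snd p)" s "- fst p"] D(1)
    by (cases p) simp
  show "((\<lambda>s. conv w \<phi> (s, x)) has_real_derivative conv w (partial_t \<phi>) (t, x)) (at t)"
    unfolding conv_def
  proof (rule has_derivative_integral_parameter[OF w _ _ Dt Bt])
    show "\<bar>s - t\<bar> \<le> 1 \<Longrightarrow> norm (t, x) + 1 + R < norm p \<Longrightarrow> \<phi> ((s, x) - p) = 0" for s p
      using far[of "(s, x)" "(t, x)" p] by (simp only: n)
  qed (use C in \<open>auto simp: n\<close>)
  have Dx: "((\<lambda>y. \<phi> ((t, y) - p)) has_real_derivative partial_x \<phi> ((t, y) - p)) (at y)" for y p
    using DERIV_shift[of "\<lambda>y. \<phi> (t - fst p, y)" "partial_x \<phi> (t - fst p, y - snd p)" y "- snd p"] D(2)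
    by (cases p) simp
  show "((\<lambda>y. conv w \<phi> (t, y)) has_real_derivative conv w (partial_x \<phi>) (t, x)) (at x)"
    unfolding conv_def
  proof (rule has_derivative_integral_parameter[OF w _ _ Dx Bx])
    show "\<bar>y - x\<bar> \<le> 1 \<Longrightarrow> norm (t, x) + 1 + R < norm p \<Longrightarrow> \<phi> ((t, y) - p) = 0" for y p
      using far[of "(t, y)" "(t, x)" p] by (simp only: n)
  qed (use C in \<open>auto simp: n\<close>)
qed

lemma conv_partial:
  assumes w: "locally_bounded_borel w" and \<phi>: "\<phi> \<in> test_functions \<Omega>"
  shows "partial_t (conv w \<phi>) = conv w (partial_t \<phi>)" "partial_x (conv w \<phi>) = conv w (partial_x \<phi>)"
  using conv_has_derivative[OF assms]
  by (auto simp: fun_eq_iff partial_t_def[of "conv w \<phi>"] partial_x_def[of "conv w \<phi>"] intro!: DERIV_imp_deriv)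

lemma C_times_conv:
  assumes w: "locally_bounded_borel w"
  shows "\<phi> \<in> test_functions \<Omega> \<Longrightarrow> C_times k (conv w \<phi>)"
proof (induction k arbitrary: \<phi>)
  case 0
  then show ?case by (simp add: conv_continuous[OF w])
next
  case (Suc k)
  show ?case
    by (rule C_times_SucI[OF conv_continuous[OF w Suc.prems] conv_has_derivative[OF w Suc.prems]])
      (intro Suc.IH test_functions_partial Suc.prems)+
qed

lemma test_functions_integrable:
  assumes w: "locally_bounded_borel w" and \<phi>: "\<phi> \<in> test_functions \<Omega>"
  shows "integrable lborel (\<lambda>p. w p * \<phi> p)"
proof -
  obtain B R where "\<And>p. \<bar>\<phi> p\<bar> \<le> B" "\<And>p. R < norm p \<Longrightarrow> \<phi> p = 0"
    using test_functions_bounds[OF \<phi>] by metis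
  then show ?thesis
    by (intro locally_bounded_borel_integrable[OF w, where B = B and R = R]
        borel_measurable_continuous_onI test_functions_continuous[OF \<phi>]) auto
qed

section \<open>Mollification converges in the mean\<close>

text \<open>Density of the continuous functions in \<open>L\<^sup>1\<close>.  By induction over integrable functions it is enough
  to treat an indicator, which is squeezed between a closed and an open set whose difference has
  small measure; a Urysohn function then differs from it only on that difference.\<close>

lemma integrable_approximate_continuous:
  fixes f :: "'a::euclidean_space \<Rightarrow> real"
  assumes "integrable lborel f" "0 < e"
  shows "\<exists>g. continuous_on UNIV g \<and> integrable lborel g \<and> (\<integral>x. \<bar>f x - g x\<bar> \<partial>lborel) < e"
  using assms
proof (induction f arbitrary: e rule: integrable_induct)
  case (base A c)
  have "A \<in> sets lebesgue" using base(1) by simp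
  define d where "d = e / (2 * (\<bar>c\<bar> + 1))"
  have d: "d > 0" using base(3) by (simp add: d_def)
  obtain U where U: "open U" "A \<subseteq> U" "emeasure lebesgue (U - A) < ennreal d"
    using sets_lebesgue_outer_open[OF \<open>A \<in> sets lebesgue\<close> d] by metis
  obtain T where T: "closed T" "T \<subseteq> A" "emeasure lebesgue (A - T) < ennreal d"
    using sets_lebesgue_inner_closed[OF \<open>A \<in> sets lebesgue\<close> d] by metis
  have [measurable]: "A \<in> sets borel" "U \<in> sets borel" "T \<in> sets borel"
    using base(1) U(1) T(1) by auto
  have "emeasure lborel (U - T) \<le> emeasure lborel (U - A) + emeasure lborel (A - T)"
    by (rule order_trans[OF emeasure_mono emeasure_subadditive]) (use base(1) in auto)
  also have "\<dots> < ennreal d + ennreal d"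
    using U(3) T(3) by (intro add_strict_mono) simp_all
  also have "\<dots> = ennreal (2 * d)"
    using d by (simp flip: ennreal_plus)
  finally have UT: "emeasure lborel (U - T) < ennreal (2 * d)" .
  have disj: "closed (- U)" "T \<inter> - U = {}" using T U by auto
  obtain h :: "'a \<Rightarrow> real" where h: "continuous_on UNIV h" "\<And>x. h x \<in> closed_segment 1 0"
    "\<And>x. x \<in> T \<Longrightarrow> h x = 1" "\<And>x. x \<in> - U \<Longrightarrow> h x = 0"
    using Urysohn[OF T(1) disj, of 1 "0 :: real"] by blast
  have h01: "0 \<le> h x" "h x \<le> 1" for x
    using h(2)[of x] by (auto simp: closed_segment_eq_real_ivl split: if_splits)
  have [measurable]: "h \<in> borel_measurable borel"
    by (rule borel_measurable_continuous_onI[OF h(1)])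
  have "emeasure lborel U \<le> emeasure lborel (U - A) + emeasure lborel A"
    using U(2) by (intro order_trans[OF emeasure_mono emeasure_subadditive]) auto
  also have "\<dots> < \<infinity>"
    using U(3) base(2) by (auto simp: less_top ennreal_add_eq_top intro: less_trans[OF _ ennreal_less_top])
  finally have fin: "emeasure lborel U < \<infinity>" .
  have int: "integrable lborel h"
    using h01 h(4) by (intro integrableI_bounded_set[where A = U and B = 1] fin) auto
  have le: "\<bar>indicator A x *\<^sub>R c - h x * c\<bar> \<le> \<bar>c\<bar> * indicator (U - T) x" for x
  proof -
    have "\<bar>indicator A x - h x\<bar> \<le> indicator (U - T) x"
      using h01[of x] h(3,4)[of x] T(2) U(2) by (auto simp: indicator_def)
    then have "\<bar>indicator A x - h x\<bar> * \<bar>c\<bar> \<le> indicator (U - T) x * \<bar>c\<bar>"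
      by (intro mult_right_mono) auto
    then show ?thesis by (simp add: abs_mult[symmetric] algebra_simps)
  qed
  have i1: "integrable lborel (\<lambda>x. \<bar>c\<bar> * indicator (U - T) x)"
    using UT by (intro integrable_mult_right integrable_real_indicator)
      (auto intro: less_trans[OF _ ennreal_less_top])
  have "(\<integral>x. \<bar>indicator A x *\<^sub>R c - h x * c\<bar> \<partial>lborel) \<le> (\<integral>x. \<bar>c\<bar> * indicator (U - T) x \<partial>lborel)"
    using base(1,2) int le
    by (intro integral_mono i1 integrable_abs Bochner_Integration.integrable_diff integrable_mult_left
        integrable_scaleR_left integrable_real_indicator) auto
  also have "\<dots> = \<bar>c\<bar> * measure lborel (U - T)" by simp
  also have "\<dots> \<le> \<bar>c\<bar> * (2 * d)"
    using UT d by (intro mult_left_mono) (auto simp: measure_def enn2real_leI)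
  also have "\<dots> < e"
    using base(3) by (simp add: d_def field_simps)
  finally show ?case
    using int h(1) by (intro exI[of _ "\<lambda>x. h x * c"]) (auto intro!: continuous_on_mult_right)
next
  case (add f g)
  obtain f' where f': "continuous_on UNIV f'" "integrable lborel f'" "(\<integral>x. \<bar>f x - f' x\<bar> \<partial>lborel) < e / 2"
    using add.IH(1)[of "e / 2"] add.prems by auto
  obtain g' where g': "continuous_on UNIV g'" "integrable lborel g'" "(\<integral>x. \<bar>g x - g' x\<bar> \<partial>lborel) < e / 2"
    using add.IH(2)[of "e / 2"] add.prems by auto
  have "(\<integral>x. \<bar>(f x + g x) - (f' x + g' x)\<bar> \<partial>lborel) \<le> (\<integral>x. \<bar>f x - f' x\<bar> + \<bar>g x - g' x\<bar> \<partial>lborel)"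
    using add.hyps f'(2) g'(2) by (intro integral_mono) auto
  also have "\<dots> = (\<integral>x. \<bar>f x - f' x\<bar> \<partial>lborel) + (\<integral>x. \<bar>g x - g' x\<bar> \<partial>lborel)"
    using add.hyps f'(2) g'(2) by (intro Bochner_Integration.integral_add) auto
  also have "\<dots> < e" using f'(3) g'(3) by simp
  finally show ?case
    using f' g' by (intro exI[of _ "\<lambda>x. f' x + g' x"]) (auto intro!: continuous_on_add)
next
  case (lim f s)
  have "(\<lambda>i. \<integral>x. \<bar>f x - s i x\<bar> \<partial>lborel) \<longlonglongrightarrow> (\<integral>x. 0 \<partial>(lborel :: 'a measure))"
  proof (rule integral_dominated_convergence[where w = "\<lambda>x. 3 * \<bar>f x\<bar>"])
    show "AE x in lborel. (\<lambda>i. \<bar>f x - s i x\<bar>) \<longlonglongrightarrow> 0"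
    proof (intro always_eventually allI)
      fix x
      have "(\<lambda>i. \<bar>f x - s i x\<bar>) \<longlonglongrightarrow> \<bar>f x - f x\<bar>"
        using lim.hyps(2)[of x] by (intro tendsto_intros) auto
      then show "(\<lambda>i. \<bar>f x - s i x\<bar>) \<longlonglongrightarrow> 0" by simp
    qed
    have "\<bar>f x - s i x\<bar> \<le> 3 * \<bar>f x\<bar>" for i x
      using lim.hyps(3)[of x i] by auto
    then show "AE x in lborel. norm \<bar>f x - s i x\<bar> \<le> 3 * \<bar>f x\<bar>" for i by simp
  qed (use lim.hyps in auto)
  then have "eventually (\<lambda>i. (\<integral>x. \<bar>f x - s i x\<bar> \<partial>lborel) < e / 2) sequentially"
    using lim.prems by (intro order_tendstoD(2)) auto
  then obtain i where i: "(\<integral>x. \<bar>f x - s i x\<bar> \<partial>lborel) < e / 2"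
    by (auto simp: eventually_sequentially)
  obtain g where g: "continuous_on UNIV g" "integrable lborel g" "(\<integral>x. \<bar>s i x - g x\<bar> \<partial>lborel) < e / 2"
    using lim.IH[of "e / 2" i] lim.prems by auto
  have "(\<integral>x. \<bar>f x - g x\<bar> \<partial>lborel) \<le> (\<integral>x. \<bar>f x - s i x\<bar> + \<bar>s i x - g x\<bar> \<partial>lborel)"
    using lim.hyps g(2) by (intro integral_mono) auto
  also have "\<dots> = (\<integral>x. \<bar>f x - s i x\<bar> \<partial>lborel) + (\<integral>x. \<bar>s i x - g x\<bar> \<partial>lborel)"
    using lim.hyps g(2) by (intro Bochner_Integration.integral_add) auto
  also have "\<dots> < e" using i g(3) by simp
  finally show ?case using g by blast
qed

text \<open>The kernel is supported in \<open>[0, e]\<^sup>2\<close> and not symmetric: the mollification at time \<open>t\<close> only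
  looks at times in \<open>[t - e, t]\<close>, so it is meaningful for all \<open>t\<close> with \<open>e < t < T\<close>.  The
  factors are written in affine form to match the closure rules for smooth functions.\<close>

definition mollifier :: "real \<Rightarrow> real \<times> real \<Rightarrow> real" where
  "mollifier e p = (pulse (1 / e * fst p + 0) * (1 / e)) * (pulse (1 / e * snd p + 0) * (1 / e))"

lemma C_times_mollifier: "C_times k (mollifier e)"
  unfolding mollifier_def
  by (intro C_times_mult C_times_compose[OF smooth1_affine[OF smooth1_pulse]] C_times_const C_times_fst C_times_snd)

lemma mollifier_nonneg: "0 < e \<Longrightarrow> 0 \<le> mollifier e p"
  by (simp add: mollifier_def pulse_nonneg)

lemma mollifier_eq_0: 
  assumes "0 < e" "p \<notin> {0..e} \<times> {0..e}"
  shows "mollifier e p = 0"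
proof -
  have "fst p / e \<le> 0 \<or> 1 \<le> fst p / e \<or> snd p / e \<le> 0 \<or> 1 \<le> snd p / e"
    using assms by (cases p) (auto simp: field_simps)
  then show ?thesis
    by (auto simp: mollifier_def pulse_eq_0)
qed

lemma mollifier_test_function: "0 < e \<Longrightarrow> mollifier e \<in> test_functions UNIV"
  by (rule test_functionsI[OF C_times_mollifier, where K = "{0..e} \<times> {0..e}"])
    (auto simp: mollifier_eq_0 intro!: compact_Times)

lemma mollifier_measurable [measurable]: "mollifier e \<in> borel_measurable borel"
  using C_times_continuous[OF C_times_mollifier] by (rule borel_measurable_continuous_onI)

lemma nn_integral_tensor:
  fixes f g :: "real \<Rightarrow> real"
  assumes [measurable]: "f \<in> borel_measurable borel" "g \<in> borel_measurable borel"
    and "\<And>x. 0 \<le> f x" "\<And>x. 0 \<le> g x"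
  shows "(\<integral>\<^sup>+p. ennreal (f (fst p) * g (snd p)) \<partial>lborel) =
    (\<integral>\<^sup>+x. ennreal (f x) \<partial>lborel) * (\<integral>\<^sup>+x. ennreal (g x) \<partial>lborel)"
proof -
  have "(\<integral>\<^sup>+p. ennreal (f (fst p) * g (snd p)) \<partial>(lborel \<Otimes>\<^sub>M lborel)) =
      (\<integral>\<^sup>+x. \<integral>\<^sup>+y. ennreal (f (fst (x, y)) * g (snd (x, y))) \<partial>lborel \<partial>lborel)"
    by (subst lborel.nn_integral_fst[symmetric]) measurable
  also have "\<dots> = (\<integral>\<^sup>+x. ennreal (f x) * (\<integral>\<^sup>+y. ennreal (g y) \<partial>lborel) \<partial>lborel)"
    using assms(3,4) by (simp add: ennreal_mult nn_integral_cmult)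
  also have "\<dots> = (\<integral>\<^sup>+x. ennreal (f x) \<partial>lborel) * (\<integral>\<^sup>+x. ennreal (g x) \<partial>lborel)"
    by (simp add: nn_integral_multc)
  finally show ?thesis by (simp add: lborel_prod)
qed

lemma pulse_measurable [measurable]: "pulse \<in> borel_measurable borel"
  by (rule borel_measurable_continuous_onI[OF smooth1_continuous[OF smooth1_pulse]])

lemma nn_integral_mollifier:
  assumes e: "0 < e"
  shows "(\<integral>\<^sup>+p. ennreal (mollifier e (q - p)) \<partial>lborel) = 1"
    and "(\<integral>\<^sup>+q. ennreal (mollifier e (q - p)) \<partial>lborel) = 1"
proof -
  let ?f = "\<lambda>a c s. pulse (a + c * s) * \<bar>c\<bar>"
  have *: "(\<integral>\<^sup>+p. ennreal (?f a c (fst p) * ?f b c (snd p)) \<partial>lborel) = 1" if "c \<noteq> 0" for a b c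
    using nn_integral_pulse_affine[OF that] by (subst nn_integral_tensor) (auto simp: pulse_nonneg)
  show "(\<integral>\<^sup>+p. ennreal (mollifier e (q - p)) \<partial>lborel) = 1"
    using *[of "- 1 / e" "fst q / e" "snd q / e"] e by (simp add: mollifier_def diff_divide_distrib)
  show "(\<integral>\<^sup>+q. ennreal (mollifier e (q - p)) \<partial>lborel) = 1"
    using *[of "1 / e" "- fst p / e" "- snd p / e"] e by (simp add: mollifier_def diff_divide_distrib)
qed

lemma has_bochner_integral_mollifier: "0 < e \<Longrightarrow> has_bochner_integral lborel (\<lambda>p. mollifier e (q - p)) 1"
  by (rule has_bochner_integral_nn_integral) (simp_all add: mollifier_nonneg nn_integral_mollifier)

lemma mollifier_support:
  assumes "0 < e" "mollifier e (q - p) \<noteq> 0"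
  shows "fst p \<in> {fst q - e..fst q}" "snd p \<in> {snd q - e..snd q}" "norm (q - p) \<le> 2 * e"
proof -
  have "q - p \<in> {0..e} \<times> {0..e}"
    using mollifier_eq_0[OF assms(1), of "q - p"] assms(2) by auto
  then have *: "0 \<le> fst q - fst p" "fst q - fst p \<le> e" "0 \<le> snd q - snd p" "snd q - snd p \<le> e"
    by (auto simp: mem_Times_iff)
  then show "fst p \<in> {fst q - e..fst q}" "snd p \<in> {snd q - e..snd q}" by auto
  show "norm (q - p) \<le> 2 * e"
    using * norm_Pair_le[of "fst (q - p)" "snd (q - p)"] unfolding prod.collapse by simp
qed

lemma conv_mollifier_diff:
  assumes w: "locally_bounded_borel w" and e: "0 < e"
  shows "conv w (mollifier e) q - c = (\<integral>p. (w p - c) * mollifier e (q - p) \<partial>lborel)"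
proof -
  have "(\<integral>p. w p * mollifier e (q - p) - c * mollifier e (q - p) \<partial>lborel)
     = conv w (mollifier e) q - c * (\<integral>p. mollifier e (q - p) \<partial>lborel)"
    using conv_integrable[OF w mollifier_test_function[OF e]] has_bochner_integral_mollifier[OF e, of q]
    unfolding conv_def
    by (subst Bochner_Integration.integral_diff) (auto simp: has_bochner_integral_iff)
  then show ?thesis
    using has_bochner_integral_mollifier[OF e, of q]
    by (simp add: has_bochner_integral_iff left_diff_distrib)
qed

text \<open>On a bounded set only the values of \<open>w\<close> on a slightly larger ball matter, so \<open>w\<close> may be taken
  integrable and is then close in \<open>L\<^sup>1\<close> to a continuous \<open>g\<close>.  Mollification moves \<open>g\<close> little by
  uniform continuity and, by Tonelli, does not increase the \<open>L\<^sup>1\<close> norm of \<open>w - g\<close>.\<close>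

lemma conv_mollifier_L1:
  assumes w: "locally_bounded_borel w" and A: "bounded A" "A \<in> sets borel" and \<delta>: "0 < \<delta>"
  shows "\<exists>e0>0. \<forall>e. 0 < e \<and> e < e0 \<longrightarrow>
     (\<integral>\<^sup>+q. ennreal (indicator A q * \<bar>conv w (mollifier e) q - w q\<bar>) \<partial>lborel) \<le> ennreal \<delta>"
proof -
  obtain R where R: "A \<subseteq> cball 0 R" "R > 0"
    using bounded_subset_ballD[OF A(1), of 0] ball_subset_cball by blast
  have [measurable]: "w \<in> borel_measurable borel" "A \<in> sets borel"
    using w A by (auto simp: locally_bounded_borel_def)
  define v where "v p = w p * indicator (cball 0 (R + 2)) p" for p
  have v: "integrable lborel v"
    unfolding v_def
    by (rule locally_bounded_borel_integrable[OF w borel_measurable_indicator, where R = "R + 2" and B = 1])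
      auto
  have [measurable]: "v \<in> borel_measurable borel" using v by auto
  obtain g where g: "continuous_on UNIV g" "integrable lborel g" "(\<integral>p. \<bar>v p - g p\<bar> \<partial>lborel) < \<delta> / 3"
    using integrable_approximate_continuous[OF v, of "\<delta> / 3"] \<delta> by auto
  have [measurable]: "g \<in> borel_measurable borel" using g(2) by auto
  have vg: "(\<integral>\<^sup>+p. ennreal \<bar>v p - g p\<bar> \<partial>lborel) \<le> ennreal (\<delta> / 3)"
    using v g(2,3) by (subst nn_integral_eq_integral) (auto intro!: ennreal_leI)
  define m where "m = measure lborel (cball (0 :: real \<times> real) R)"
  have m: "0 \<le> m" "emeasure lborel (cball (0 :: real \<times> real) R) = ennreal m"
    using emeasure_bounded_finite[OF bounded_cball, of "0 :: real \<times> real" R]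
    by (auto simp: m_def measure_def less_top)
  \<comment> \<open>The oscillation allowed for \<open>g\<close>: integrated over the ball it contributes at most \<open>\<delta> / 3\<close>.\<close>
  define \<eta> where "\<eta> = \<delta> / 3 / (m + 1)"
  have \<eta>: "0 < \<eta>" "\<eta> * m \<le> \<delta> / 3"
    using m(1) \<delta> by (auto simp: \<eta>_def field_simps)
  have "uniformly_continuous_on (cball 0 (R + 2)) g"
    using g(1) by (intro compact_uniformly_continuous) (auto intro: continuous_on_subset)
  then obtain d where d: "0 < d"
    "\<And>p q. p \<in> cball 0 (R + 2) \<Longrightarrow> q \<in> cball 0 (R + 2) \<Longrightarrow> dist p q < d \<Longrightarrow> dist (g p) (g q) < \<eta>"
    using \<eta>(1) unfolding uniformly_continuous_on_def by metis
  have ind: "(\<lambda>q :: real \<times> real. ennreal (\<eta> * indicator (cball 0 R) q)) = (\<lambda>q. ennreal \<eta> * indicator (cball 0 R) q)"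
    by (rule ext) (simp split: split_indicator)
  show ?thesis
  proof (intro exI[of _ "min 1 (d / 2)"] conjI allI impI; (elim conjE)?)
    fix e assume e: "0 < e" "e < min 1 (d / 2)"
    have pt: "ennreal (indicator A q * \<bar>conv w (mollifier e) q - w q\<bar>) \<le>
        (\<integral>\<^sup>+p. ennreal (\<bar>v p - g p\<bar> * mollifier e (q - p)) \<partial>lborel)
          + (ennreal (\<eta> * indicator (cball 0 R) q) + ennreal \<bar>v q - g q\<bar>)" (is "_ \<le> ?r") for q
    proof (cases "q \<in> A")
      case True
      then have q: "norm q \<le> R" using R by auto
      have "\<bar>conv w (mollifier e) q - w q\<bar> = \<bar>\<integral>p. (w p - w q) * mollifier e (q - p) \<partial>lborel\<bar>"
        by (simp add: conv_mollifier_diff[OF w e(1)])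
      also have "ennreal \<dots> \<le> (\<integral>\<^sup>+p. ennreal \<bar>(w p - w q) * mollifier e (q - p)\<bar> \<partial>lborel)"
        using integral_norm_bound_ennreal[of lborel "\<lambda>p. (w p - w q) * mollifier e (q - p)"]
          conv_integrable[OF w mollifier_test_function[OF e(1)], of q] has_bochner_integral_mollifier[OF e(1), of q]
        by (simp add: left_diff_distrib has_bochner_integral_iff)
      also have "\<dots> \<le> (\<integral>\<^sup>+p. ennreal (\<bar>v p - g p\<bar> * mollifier e (q - p))
           + ennreal (\<eta> + \<bar>v q - g q\<bar>) * ennreal (mollifier e (q - p)) \<partial>lborel)"
      proof (rule nn_integral_mono)
        fix p
        show "ennreal \<bar>(w p - w q) * mollifier e (q - p)\<bar> \<le> ennreal (\<bar>v p - g p\<bar> * mollifier e (q - p))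
           + ennreal (\<eta> + \<bar>v q - g q\<bar>) * ennreal (mollifier e (q - p))"
        proof (cases "mollifier e (q - p) = 0")
          case False
          note near = mollifier_support(3)[OF e(1) False]
          have p: "norm p \<le> R + 2"
            using near q e(2) norm_triangle_ineq2[of p q] by (simp add: norm_minus_commute)
          have "dist (g p) (g q) < \<eta>"
            using p q near e(2) by (intro d(2)) (auto simp: dist_norm norm_minus_commute)
          then have "\<bar>w p - w q\<bar> \<le> \<bar>v p - g p\<bar> + (\<eta> + \<bar>v q - g q\<bar>)"
            using p q by (simp add: v_def dist_real_def)
          then have "\<bar>(w p - w q) * mollifier e (q - p)\<bar>
              \<le> \<bar>v p - g p\<bar> * mollifier e (q - p) + (\<eta> + \<bar>v q - g q\<bar>) * mollifier e (q - p)"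
            using mollifier_nonneg[OF e(1), of "q - p"]
            by (simp add: abs_mult distrib_right[symmetric] mult_right_mono)
          then show ?thesis
            using \<eta>(1) mollifier_nonneg[OF e(1), of "q - p"]
            by (simp add: ennreal_mult[symmetric] ennreal_leI flip: ennreal_plus)
        qed simp
      qed
      also have "\<dots> = (\<integral>\<^sup>+p. ennreal (\<bar>v p - g p\<bar> * mollifier e (q - p)) \<partial>lborel) + ennreal (\<eta> + \<bar>v q - g q\<bar>)"
        by (simp add: nn_integral_add nn_integral_cmult nn_integral_mollifier[OF e(1)])
      also have "\<dots> = ?r"
        using q \<eta>(1) by simp
      finally show ?thesis using True by simp
    qed simp
    have "(\<integral>\<^sup>+q. ennreal (indicator A q * \<bar>conv w (mollifier e) q - w q\<bar>) \<partial>lborel) \<le>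
      (\<integral>\<^sup>+q. (\<integral>\<^sup>+p. ennreal (\<bar>v p - g p\<bar> * mollifier e (q - p)) \<partial>lborel)
          + (ennreal (\<eta> * indicator (cball 0 R) q) + ennreal \<bar>v q - g q\<bar>) \<partial>lborel)"
      by (rule nn_integral_mono) (rule pt)
    also have "\<dots> = (\<integral>\<^sup>+q. \<integral>\<^sup>+p. ennreal (\<bar>v p - g p\<bar> * mollifier e (q - p)) \<partial>lborel \<partial>lborel)
        + ((\<integral>\<^sup>+q. ennreal (\<eta> * indicator (cball 0 R) q) \<partial>(lborel :: (real \<times> real) measure)) + (\<integral>\<^sup>+q. ennreal \<bar>v q - g q\<bar> \<partial>lborel))"
    proof -
      have 1: "(\<lambda>q. \<integral>\<^sup>+p. ennreal (\<bar>v p - g p\<bar> * mollifier e (q - p)) \<partial>lborel) \<in> borel_measurable lborel"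
        by (rule lborel.borel_measurable_nn_integral) measurable
      have 2: "(\<lambda>q :: real \<times> real. ennreal (\<eta> * indicator (cball 0 R) q)) \<in> borel_measurable lborel"
        unfolding ind by (intro borel_measurable_times_ennreal borel_measurable_const borel_measurable_indicator) simp
      have 3: "(\<lambda>q. ennreal \<bar>v q - g q\<bar>) \<in> borel_measurable lborel" by measurable
      show ?thesis
        unfolding nn_integral_add[OF 1 borel_measurable_add[OF 2 3]] nn_integral_add[OF 2 3] ..
    qed
    also have "(\<integral>\<^sup>+q. \<integral>\<^sup>+p. ennreal (\<bar>v p - g p\<bar> * mollifier e (q - p)) \<partial>lborel \<partial>lborel)
       = (\<integral>\<^sup>+p. \<integral>\<^sup>+q. ennreal (\<bar>v p - g p\<bar> * mollifier e (q - p)) \<partial>lborel \<partial>lborel)"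
      by (rule lborel_pair.Fubini') measurable
    also have "\<dots> = (\<integral>\<^sup>+p. ennreal \<bar>v p - g p\<bar> \<partial>lborel)"
      using mollifier_nonneg[OF e(1)]
      by (simp add: ennreal_mult nn_integral_cmult nn_integral_mollifier(2)[OF e(1)])
    also have "(\<integral>\<^sup>+q. ennreal (\<eta> * indicator (cball 0 R) q) \<partial>(lborel :: (real \<times> real) measure)) = ennreal (\<eta> * m)"
      unfolding ind using \<eta>(1) m by (subst nn_integral_cmult_indicator) (auto simp: ennreal_mult)
    also have "(\<integral>\<^sup>+p. ennreal \<bar>v p - g p\<bar> \<partial>lborel) + (ennreal (\<eta> * m) + (\<integral>\<^sup>+q. ennreal \<bar>v q - g q\<bar> \<partial>lborel))
       \<le> ennreal (\<delta> / 3) + (ennreal (\<delta> / 3) + ennreal (\<delta> / 3))"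
      using \<eta>(2) by (intro add_mono vg ennreal_leI)
    also have "\<dots> = ennreal \<delta>"
      using \<delta> by (simp flip: ennreal_plus)
    finally show "(\<integral>\<^sup>+q. ennreal (indicator A q * \<bar>conv w (mollifier e) q - w q\<bar>) \<partial>lborel) \<le> ennreal \<delta>" .
  qed (use d in simp)
qed

section \<open>Fields with a Hamiltonian\<close>

lemma continuous_compact_support_bounded:
  fixes f :: "real \<Rightarrow> real"
  assumes "continuous_on UNIV f" "\<And>x. x \<notin> {a..c} \<Longrightarrow> f x = 0"
  obtains B where "0 \<le> B" "\<And>x. \<bar>f x\<bar> \<le> B"
proof -
  have "bounded (f ` {a..c})"
    using assms(1) by (intro compact_imp_bounded compact_continuous_image) (auto intro: continuous_on_subset)
  then obtain B where B: "\<And>x. x \<in> {a..c} \<Longrightarrow> \<bar>f x\<bar> \<le> B"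
    unfolding bounded_iff real_norm_def by blast
  show thesis
  proof (rule that[of "max B 0"])
    show "\<bar>f x\<bar> \<le> max B 0" for x
      using B[of x] assms(2)[of x] by (cases "x \<in> {a..c}") auto
  qed simp
qed

lemma derivative_support:
  fixes f :: "real \<Rightarrow> real"
  assumes "\<And>x. (f has_real_derivative f' x) (at x)" "\<And>x. x \<notin> {a..c} \<Longrightarrow> f x = 0" "x \<notin> {a..c}"
  shows "f' x = 0"
proof -
  have "eventually (\<lambda>y. y \<in> - {a..c}) (nhds x)"
    using assms(3) by (intro eventually_nhds_in_open) auto
  then have "eventually (\<lambda>y. f y = 0) (nhds x)"
    by (rule eventually_mono) (use assms(2) in auto)
  then have "(f has_real_derivative 0) (at x)"
    by (subst DERIV_cong_ev[OF refl _ refl]) auto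
  with assms(1) show ?thesis by (rule DERIV_unique)
qed

text \<open>The data of a flow in terms of representatives on the whole plane: a Borel field \<open>b\<close> that is
  bounded everywhere, a density \<open>r\<close> extended by \<open>0\<close>, and a Hamiltonian \<open>H\<close> with gradient
  \<open>(- r b, r)\<close> in the sense of distributions.\<close>

locale hamiltonian_field =
  fixes T L m M C :: real and H r b :: "real \<times> real \<Rightarrow> real"
  assumes T: "0 < T"
    and lip: "L-lipschitz_on ({0..T} \<times> UNIV) H"
    and m: "0 < m"
    and r_borel [measurable]: "r \<in> borel_measurable borel"
    and b_borel [measurable]: "b \<in> borel_measurable borel"
    and r_zero: "\<And>p. p \<notin> spacetime T \<Longrightarrow> r p = 0"
    and r_lower: "\<And>p. p \<in> spacetime T \<Longrightarrow> m \<le> r p"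
    and r_upper: "\<And>p. p \<in> spacetime T \<Longrightarrow> r p \<le> M"
    and b_bound: "\<And>p. \<bar>b p\<bar> \<le> C"
    and weak_x: "\<And>\<phi>. \<phi> \<in> test_functions (spacetime T) \<Longrightarrow>
       (\<integral>p. (indicator (spacetime T) p * H p) * partial_x \<phi> p \<partial>lborel) = - (\<integral>p. r p * \<phi> p \<partial>lborel)"
    and weak_t: "\<And>\<phi>. \<phi> \<in> test_functions (spacetime T) \<Longrightarrow>
       (\<integral>p. (indicator (spacetime T) p * H p) * partial_t \<phi> p \<partial>lborel) = (\<integral>p. (r p * b p) * \<phi> p \<partial>lborel)"
begin

text \<open>\<open>H\<close> is controlled on the closed strip only; the cut-off version is Borel on the whole plane and
  can be convolved.\<close>

definition H_ext :: "real \<times> real \<Rightarrow> real" where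
  "H_ext p = indicator (spacetime T) p * H p"

definition flux :: "real \<times> real \<Rightarrow> real" where
  "flux p = r p * b p"

lemma mem_spacetime: "(t, x) \<in> spacetime T \<longleftrightarrow> 0 < t \<and> t < T"
  by (auto simp: spacetime_def)

lemma spacetime_borel [measurable]: "spacetime T \<in> sets borel"
  by (auto simp: spacetime_def intro!: borel_open open_Times)

lemma C_nonneg: "0 \<le> C"
  using b_bound[of undefined] by linarith

lemma L_nonneg: "0 \<le> L"
  using lipschitz_on_nonneg[OF lip] .

lemma H_lipschitz:
  assumes "t \<in> {0..T}" "s \<in> {0..T}"
  shows "\<bar>H (t, x) - H (s, y)\<bar> \<le> L * norm ((t, x) - (s, y))"
  using lipschitz_onD[OF lip, of "(t, x)" "(s, y)"] assms by (simp add: dist_real_def dist_norm)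

lemma H_continuous: "continuous_on ({0..T} \<times> UNIV) H"
  by (rule lipschitz_on_continuous_on[OF lip])

lemma H_ext_eq: "0 < t \<Longrightarrow> t < T \<Longrightarrow> H_ext (t, x) = H (t, x)"
  by (simp add: H_ext_def mem_spacetime)

lemma H_ext_locally_bounded: "locally_bounded_borel H_ext"
  unfolding locally_bounded_borel_def
proof (intro conjI allI)
  have "continuous_on (spacetime T) H"
    using H_continuous by (rule continuous_on_subset) (auto simp: spacetime_def)
  from borel_measurable_continuous_on_indicator[OF spacetime_borel this]
  show "H_ext \<in> borel_measurable borel"
    by (simp add: H_ext_def[abs_def])
  fix R :: real
  show "\<exists>B. \<forall>p\<in>cball 0 R. \<bar>H_ext p\<bar> \<le> B"
  proof (intro exI ballI)
    fix p :: "real \<times> real" assume p: "p \<in> cball 0 R"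
    show "\<bar>H_ext p\<bar> \<le> \<bar>H (0, 0)\<bar> + L * \<bar>R\<bar>"
    proof (cases "p \<in> spacetime T")
      case True
      obtain t x where tx: "p = (t, x)" by (cases p)
      have "\<bar>H p - H (0, 0)\<bar> \<le> L * norm (p - (0, 0))"
        using True T unfolding tx by (intro H_lipschitz) (auto simp: mem_spacetime)
      also have "\<dots> \<le> L * \<bar>R\<bar>"
        using p L_nonneg by (intro mult_left_mono) (auto simp: zero_prod_def[symmetric])
      finally show ?thesis using True by (simp add: H_ext_def)
    qed (use L_nonneg in \<open>simp add: H_ext_def\<close>)
  qed
qed

lemma r_nonneg: "0 \<le> r p"
  using r_zero[of p] r_lower[of p] m by (cases "p \<in> spacetime T") auto

lemma r_le: "r p \<le> \<bar>M\<bar>"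
  using r_zero[of p] r_upper[of p] by (cases "p \<in> spacetime T") auto

lemma r_locally_bounded: "locally_bounded_borel r"
  using r_le r_nonneg by (intro locally_bounded_borelI[OF r_borel, of "\<bar>M\<bar>"]) (auto simp: abs_of_nonneg)

lemma flux_locally_bounded: "locally_bounded_borel flux"
proof (rule locally_bounded_borelI)
  show "flux \<in> borel_measurable borel" unfolding flux_def[abs_def] by measurable
  show "\<bar>flux p\<bar> \<le> \<bar>M\<bar> * C" for p
    using r_le[of p] r_nonneg[of p] b_bound[of p] by (auto simp: flux_def abs_mult intro!: mult_mono)
qed

abbreviation H_moll :: "real \<Rightarrow> real \<times> real \<Rightarrow> real" where
  "H_moll e \<equiv> conv H_ext (mollifier e)"

lemma H_moll_smooth: "0 < e \<Longrightarrow> C_times k (H_moll e)"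
  by (rule C_times_conv[OF H_ext_locally_bounded mollifier_test_function])

text \<open>The translated reflected kernel is a test function once its support lies in the domain, so the
  weak equations say exactly that differentiation commutes with mollification there.\<close>

lemma H_moll_partial:
  assumes e: "0 < e" "e < t" "t < T"
  shows "partial_x (H_moll e) (t, x) = conv r (mollifier e) (t, x)"
    and "partial_t (H_moll e) (t, x) = - conv flux (mollifier e) (t, x)"
proof -
  let ?\<phi> = "\<lambda>p. mollifier e ((t, x) - p)"
  have test: "?\<phi> \<in> test_functions (spacetime T)"
  proof (rule test_functionsI[where K = "{t - e..t} \<times> {x - e..x}"])
    show "C_times k ?\<phi>" for k
      by (rule C_times_translate_reflect[OF C_times_mollifier])
    show "?\<phi> p = 0" if "p \<notin> {t - e..t} \<times> {x - e..x}" for p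
      using mollifier_support(1,2)[OF e(1), of "(t, x)" p] that by (auto simp: mem_Times_iff)
  qed (use e in \<open>auto intro!: compact_Times simp: mem_spacetime\<close>)
  note D = partial_translate_reflect[OF C_times_mollifier, of e "(t, x)"]
  show "partial_x (H_moll e) (t, x) = conv r (mollifier e) (t, x)"
    using weak_x[OF test] conv_partial(2)[OF H_ext_locally_bounded mollifier_test_function[OF e(1)]]
    by (simp add: D(2) conv_def H_ext_def)
  show "partial_t (H_moll e) (t, x) = - conv flux (mollifier e) (t, x)"
    using weak_t[OF test] conv_partial(1)[OF H_ext_locally_bounded mollifier_test_function[OF e(1)]]
    by (simp add: D(1) conv_def H_ext_def flux_def)
qed

lemma H_moll_close:
  assumes e: "0 < e" "e < t" "t < T"
  shows "\<bar>H_moll e (t, x) - H (t, x)\<bar> \<le> 2 * L * e"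
proof -
  let ?q = "(t, x)"
  have int: "integrable lborel (\<lambda>p. 2 * L * e * mollifier e (?q - p))" "(\<integral>p. 2 * L * e * mollifier e (?q - p) \<partial>lborel) = 2 * L * e"
    using has_bochner_integral_mollifier[OF e(1), of ?q] by (auto simp: has_bochner_integral_iff)
  have "integrable lborel (\<lambda>p. H_ext p * mollifier e (?q - p) - H ?q * mollifier e (?q - p))"
    using conv_integrable[OF H_ext_locally_bounded mollifier_test_function[OF e(1)]] has_bochner_integral_mollifier[OF e(1), of ?q]
    by (intro Bochner_Integration.integrable_diff) (auto simp: has_bochner_integral_iff)
  then have int2: "integrable lborel (\<lambda>p. (H_ext p - H ?q) * mollifier e (?q - p))"
    by (simp add: left_diff_distrib)
  have pt: "\<bar>(H_ext p - H ?q) * mollifier e (?q - p)\<bar> \<le> 2 * L * e * mollifier e (?q - p)" for p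
  proof (cases "mollifier e (?q - p) = 0")
    case False
    note near = mollifier_support[OF e(1) False]
    obtain s y where p: "p = (s, y)" by (cases p)
    have s: "0 < s" "s < T" using near(1) e p by auto
    have "\<bar>H (s, y) - H ?q\<bar> \<le> L * norm ((s, y) - ?q)"
      using s e by (intro H_lipschitz) auto
    also have "\<dots> \<le> L * (2 * e)"
      using near(3) L_nonneg norm_minus_commute[of ?q p] unfolding p by (intro mult_left_mono) simp_all
    finally have "\<bar>H_ext p - H ?q\<bar> \<le> 2 * L * e" using s by (simp add: p H_ext_eq)
    then show ?thesis
      using mollifier_nonneg[OF e(1), of "?q - p"] by (simp add: abs_mult mult_right_mono)
  qed simp
  have "\<bar>H_moll e ?q - H ?q\<bar> = \<bar>\<integral>p. (H_ext p - H ?q) * mollifier e (?q - p) \<partial>lborel\<bar>"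
    by (simp add: conv_mollifier_diff[OF H_ext_locally_bounded e(1)])
  also have "\<dots> \<le> (\<integral>p. \<bar>(H_ext p - H ?q) * mollifier e (?q - p)\<bar> \<partial>lborel)"
    by (rule integral_abs_bound)
  also have "\<dots> \<le> (\<integral>p. 2 * L * e * mollifier e (?q - p) \<partial>lborel)"
    by (intro integral_mono integrable_abs int int2 pt)
  finally show ?thesis unfolding int(2) .
qed

text \<open>The derivative of the mollified Hamiltonian in the direction \<open>(\<alpha>, \<beta>)\<close> is an average of
  \<open>\<beta> r - \<alpha> r b\<close>.\<close>

lemma H_moll_directional_lower:
  assumes "\<And>p. p \<in> spacetime T \<Longrightarrow> \<mu> \<le> \<beta> * r p - \<alpha> * flux p"
    and e: "0 < e" "e < t" "t < T"
  shows "\<mu> \<le> \<alpha> * partial_t (H_moll e) (t, x) + \<beta> * partial_x (H_moll e) (t, x)"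
proof -
  let ?q = "(t, x)"
  have mo: "integrable lborel (\<lambda>p. mollifier e (?q - p))" "(\<integral>p. mollifier e (?q - p) \<partial>lborel) = 1"
    using has_bochner_integral_mollifier[OF e(1), of ?q] by (auto simp: has_bochner_integral_iff)
  note int = conv_integrable[OF r_locally_bounded mollifier_test_function[OF e(1)], of ?q]
    conv_integrable[OF flux_locally_bounded mollifier_test_function[OF e(1)], of ?q]
  have "\<mu> = (\<integral>p. \<mu> * mollifier e (?q - p) \<partial>lborel)" by (simp add: mo)
  also have "\<dots> \<le> (\<integral>p. \<beta> * (r p * mollifier e (?q - p)) - \<alpha> * (flux p * mollifier e (?q - p)) \<partial>lborel)"
  proof (intro integral_mono Bochner_Integration.integrable_diff integrable_mult_right mo int)
    fix p
    show "\<mu> * mollifier e (?q - p) \<le> \<beta> * (r p * mollifier e (?q - p)) - \<alpha> * (flux p * mollifier e (?q - p))"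
    proof (cases "mollifier e (?q - p) = 0")
      case False
      have "p \<in> spacetime T"
        using mollifier_support(1)[OF e(1) False] e by (cases p) (auto simp: mem_spacetime)
      from mult_right_mono[OF assms(1)[OF this] mollifier_nonneg[OF e(1), of "?q - p"]] show ?thesis
        by (simp add: algebra_simps)
    qed simp
  qed
  also have "\<dots> = \<beta> * conv r (mollifier e) ?q - \<alpha> * conv flux (mollifier e) ?q"
    using int by (simp add: conv_def)
  finally show ?thesis by (simp add: H_moll_partial[OF e])
qed

text \<open>The mollified Hamiltonian satisfies the inequality up to an error of order \<open>e\<close> by the mean
  value theorem along the segment; then \<open>e\<close> tends to \<open>0\<close>.\<close>

lemma H_directional_lower_interior:
  assumes low: "\<And>p. p \<in> spacetime T \<Longrightarrow> \<mu> \<le> \<beta> * r p - \<alpha> * flux p"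
    and t: "0 < t" "t < T" "0 < t + s * \<alpha>" "t + s * \<alpha> < T" and s: "0 \<le> s"
  shows "H (t, x) + s * \<mu> \<le> H (t + s * \<alpha>, x + s * \<beta>)"
proof -
  define e0 where "e0 = min t (t + s * \<alpha>)"
  have e0: "0 < e0" using t by (simp add: e0_def)
  have *: "H (t, x) + s * \<mu> - 4 * L * e \<le> H (t + s * \<alpha>, x + s * \<beta>)" if e: "0 < e" "e < e0" for e
  proof -
    let ?g = "\<lambda>u. H_moll e (t + u * \<alpha>, x + u * \<beta>) - u * \<mu>"
    have range: "e < t + u * \<alpha>" "t + u * \<alpha> < T" if u: "0 \<le> u" "u \<le> s" for u
    proof -
      have "min t (t + s * \<alpha>) \<le> t + u * \<alpha> \<and> t + u * \<alpha> \<le> max t (t + s * \<alpha>)"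
      proof (cases "0 \<le> \<alpha>")
        case True
        then have "0 \<le> u * \<alpha>" "u * \<alpha> \<le> s * \<alpha>" using u by (auto intro: mult_right_mono)
        then show ?thesis by auto
      next
        case False
        then have "u * \<alpha> \<le> 0" "s * \<alpha> \<le> u * \<alpha>" using u by (auto intro: mult_nonneg_nonpos mult_right_mono_neg)
        then show ?thesis by auto
      qed
      then show "e < t + u * \<alpha>" "t + u * \<alpha> < T" using e t by (auto simp: e0_def)
    qed
    have "?g 0 \<le> ?g s"
    proof (rule DERIV_nonneg_imp_nondecreasing[OF s])
      fix u assume u: "0 \<le> u" "u \<le> s"
      have "(?g has_real_derivative \<alpha> * partial_t (H_moll e) (t + u * \<alpha>, x + u * \<beta>)
          + \<beta> * partial_x (H_moll e) (t + u * \<alpha>, x + u * \<beta>) - \<mu>) (at u)"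
        using C_times_directional_derivative[OF H_moll_smooth[OF e(1)], of t \<alpha> x \<beta> u]
        by (auto intro!: derivative_eq_intros)
      with H_moll_directional_lower[OF low e(1) range[OF u], of "x + u * \<beta>"]
      show "\<exists>y. (?g has_real_derivative y) (at u) \<and> 0 \<le> y" by auto
    qed
    then show ?thesis
      using H_moll_close[OF e(1) range[of 0], of x] H_moll_close[OF e(1) range[of s], of "x + s * \<beta>"] s by auto
  qed
  have "((\<lambda>e. H (t, x) + s * \<mu> - 4 * L * e) \<longlongrightarrow> H (t, x) + s * \<mu> - 4 * L * 0) (at_right 0)"
    by (intro tendsto_intros)
  moreover have "eventually (\<lambda>e. H (t, x) + s * \<mu> - 4 * L * e \<le> H (t + s * \<alpha>, x + s * \<beta>)) (at_right 0)"
    using * e0 by (auto simp: eventually_at_right_field)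
  ultimately show ?thesis
    using tendsto_upperbound[of _ _ "at_right (0 :: real)"] by force
qed

text \<open>Segments that touch the initial or final time are limits of segments shrunk towards the middle
  time \<open>T / 2\<close>.\<close>

lemma H_directional_lower:
  assumes low: "\<And>p. p \<in> spacetime T \<Longrightarrow> \<mu> \<le> \<beta> * r p - \<alpha> * flux p"
    and t: "t \<in> {0..T}" "t + s * \<alpha> \<in> {0..T}" and s: "0 \<le> s"
  shows "H (t, x) + s * \<mu> \<le> H (t + s * \<alpha>, x + s * \<beta>)"
proof -
  let ?t = "\<lambda>l. (1 - l) * t + l * (T / 2)" and ?s = "\<lambda>l. (1 - l) * s"
  have in01: "0 < (1 - l) * u + l * (T / 2)" "(1 - l) * u + l * (T / 2) < T"
    if "u \<in> {0..T}" "0 < l" "l < 1" for u l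
  proof -
    have "(1 - l) * u \<le> (1 - l) * T" "0 \<le> (1 - l) * u" "0 < l * T" using that T by auto
    then show "0 < (1 - l) * u + l * (T / 2)" "(1 - l) * u + l * (T / 2) < T"
      by (auto simp: algebra_simps)
  qed
  have eq: "?t l + ?s l * \<alpha> = (1 - l) * (t + s * \<alpha>) + l * (T / 2)" for l
    by (simp add: algebra_simps)
  have *: "H (?t l, x) + ?s l * \<mu> \<le> H (?t l + ?s l * \<alpha>, x + ?s l * \<beta>)" if "0 < l" "l < 1" for l
  proof (rule H_directional_lower_interior[OF low])
    show "0 < ?t l + ?s l * \<alpha>" "?t l + ?s l * \<alpha> < T"
      unfolding eq by (rule in01[OF t(2) that])+
  qed (use in01[OF t(1) that] s that in simp_all)
  have lim: "((\<lambda>l. H (f l, g l)) \<longlongrightarrow> H (f 0, g 0)) (at_right 0)"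
    if "continuous_on UNIV f" "continuous_on UNIV g" "f 0 \<in> {0..T}" "\<And>l. 0 < l \<Longrightarrow> l < 1 \<Longrightarrow> f l \<in> {0..T}"
    for f g :: "real \<Rightarrow> real"
  proof (rule continuous_on_tendsto_compose[OF H_continuous])
    show "((\<lambda>l. (f l, g l)) \<longlongrightarrow> (f 0, g 0)) (at_right 0)"
      using that(1,2) by (intro tendsto_Pair) (auto simp: continuous_on_def intro: tendsto_within_subset)
    show "eventually (\<lambda>l. (f l, g l) \<in> {0..T} \<times> UNIV) (at_right 0)"
      using that(4) by (auto simp: eventually_at_right_field intro!: exI[of _ 1])
  qed (use that in auto)
  have "((\<lambda>l. H (?t l, x) + ?s l * \<mu>) \<longlongrightarrow> H (?t 0, x) + ?s 0 * \<mu>) (at_right 0)"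
    using in01[OF t(1)] t by (intro tendsto_add lim tendsto_intros continuous_intros) (auto intro: less_imp_le)
  moreover have "((\<lambda>l. H (?t l + ?s l * \<alpha>, x + ?s l * \<beta>)) \<longlongrightarrow> H (?t 0 + ?s 0 * \<alpha>, x + ?s 0 * \<beta>)) (at_right 0)"
    using in01[OF t(2)] t unfolding eq by (intro lim continuous_intros) (auto intro: less_imp_le)
  moreover have "eventually (\<lambda>l. H (?t l, x) + ?s l * \<mu> \<le> H (?t l + ?s l * \<alpha>, x + ?s l * \<beta>)) (at_right 0)"
    using * by (auto simp: eventually_at_right_field intro!: exI[of _ 1])
  ultimately have "H (?t 0, x) + ?s 0 * \<mu> \<le> H (?t 0 + ?s 0 * \<alpha>, x + ?s 0 * \<beta>)"
    by (intro tendsto_le[of "at_right (0 :: real)"]) auto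
  then show ?thesis by simp
qed

lemma H_increasing:
  assumes "t \<in> {0..T}" "x \<le> y"
  shows "H (t, x) + m * (y - x) \<le> H (t, y)"
  using H_directional_lower[of m 1 0 t "y - x" x] r_lower assms by (simp add: mult.commute)

text \<open>The cone condition: in the directions \<open>(1, C)\<close> and \<open>(- 1, C)\<close> the derivative of \<open>H\<close> is
  \<open>(C - b) r\<close> and \<open>(C + b) r\<close>, which is nonnegative.\<close>

lemma H_forward:
  assumes "0 \<le> s" "s \<le> t" "t \<le> T"
  shows "H (s, x) \<le> H (t, x + C * (t - s))" and "H (t, x) \<le> H (s, x + C * (t - s))"
proof -
  have "0 \<le> (C - b p) * r p" "0 \<le> (C + b p) * r p" for p
    using b_bound[of p] r_nonneg[of p] by (auto intro!: mult_nonneg_nonneg)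
  then have *: "0 \<le> C * r p - 1 * flux p" "0 \<le> C * r p - (- 1) * flux p" for p
    by (simp_all add: flux_def algebra_simps)
  show "H (s, x) \<le> H (t, x + C * (t - s))"
    using H_directional_lower[OF *(1), of s "t - s" x] assms by (simp add: mult.commute)
  show "H (t, x) \<le> H (s, x + C * (t - s))"
    using H_directional_lower[OF *(2), of t "t - s" x] assms by (simp add: mult.commute)
qed

section \<open>The flow along level lines\<close>

lemma H_le_iff:
  assumes "t \<in> {0..T}"
  shows "H (t, x) \<le> H (t, y) \<longleftrightarrow> x \<le> y"
proof
  assume le: "H (t, x) \<le> H (t, y)"
  show "x \<le> y"
  proof (rule ccontr)
    assume "\<not> x \<le> y"
    then have "0 < m * (x - y)" using m by simp
    with H_increasing[OF assms, of y x] le \<open>\<not> x \<le> y\<close> show False by simp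
  qed
next
  assume "x \<le> y"
  moreover from this have "0 \<le> m * (y - x)" using m by simp
  ultimately show "H (t, x) \<le> H (t, y)" using H_increasing[OF assms, of x y] by simp
qed

lemma H_level_inverse:
  assumes t: "t \<in> {0..T}"
  shows "H (t, level_inverse H t h) = h"
proof -
  define d where "d = \<bar>h - H (t, 0)\<bar> / m"
  have d: "0 \<le> d" "m * d = \<bar>h - H (t, 0)\<bar>" using m by (auto simp: d_def)
  have "\<exists>y. - d \<le> y \<and> y \<le> d \<and> H (t, y) = h"
  proof (rule IVT')
    show "H (t, - d) \<le> h" using H_increasing[OF t, of "- d" 0] d by auto
    show "h \<le> H (t, d)" using H_increasing[OF t, of 0 d] d by auto
    show "continuous_on {- d..d} (\<lambda>y. H (t, y))"
      by (rule continuous_on_compose2[OF H_continuous]) (use t in \<open>auto intro!: continuous_intros\<close>)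
  qed (use d in simp)
  then obtain y where y: "H (t, y) = h" by blast
  have "z = y" if "H (t, z) = h" for z
    using H_le_iff[OF t, of z y] H_le_iff[OF t, of y z] y that by auto
  then show ?thesis
    unfolding level_inverse_def using y by (rule_tac theI) auto
qed

definition flow :: "real \<Rightarrow> real \<Rightarrow> real" where
  "flow t x = level_inverse H t (H (0, x))"

lemma H_flow: "t \<in> {0..T} \<Longrightarrow> H (t, flow t x) = H (0, x)"
  by (simp add: flow_def H_level_inverse)

lemma flow_0: "flow 0 x = x"
  using H_flow[of 0 x] H_le_iff[of 0 x "flow 0 x"] H_le_iff[of 0 "flow 0 x" x] T by auto

lemma flow_time_lipschitz_le:
  assumes "0 \<le> s" "s \<le> t" "t \<le> T"
  shows "\<bar>flow t x - flow s x\<bar> \<le> C * (t - s)"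
proof -
  have "H (t, flow t x) \<le> H (t, flow s x + C * (t - s))"
    using H_forward(1)[OF assms, of "flow s x"] assms by (simp add: H_flow)
  moreover have "H (s, flow s x) \<le> H (s, flow t x + C * (t - s))"
    using H_forward(2)[OF assms, of "flow t x"] assms by (simp add: H_flow)
  ultimately show ?thesis using assms by (simp add: H_le_iff abs_le_iff)
qed

lemma flow_time_lipschitz:
  assumes "s \<in> {0..T}" "t \<in> {0..T}"
  shows "\<bar>flow t x - flow s x\<bar> \<le> C * \<bar>t - s\<bar>"
  using flow_time_lipschitz_le[of s t x] flow_time_lipschitz_le[of t s x] assms
  by (cases "s \<le> t") (auto simp: abs_minus_commute)

lemma H_coercive:
  assumes t: "t \<in> {0..T}"
  shows "m * \<bar>x\<bar> \<le> \<bar>H (t, x)\<bar> + (\<bar>H (0, 0)\<bar> + L * T)"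
proof -
  have "m * \<bar>x\<bar> \<le> \<bar>H (t, x) - H (t, 0)\<bar>"
    using H_increasing[OF t, of 0 x] H_increasing[OF t, of x 0] by (cases "0 \<le> x") auto
  moreover have "\<bar>H (t, 0) - H (0, 0)\<bar> \<le> L * norm ((t, 0 :: real) - (0, 0))"
    using t T by (intro H_lipschitz) auto
  moreover have "L * norm ((t, 0 :: real) - (0, 0)) \<le> L * T"
    using t L_nonneg by (intro mult_left_mono) (auto simp: norm_Pair)
  ultimately show ?thesis by linarith
qed

section \<open>Other densities are transported by the flow\<close>

text \<open>A bound for the positions at which \<open>H\<close>, or any function within \<open>2 L\<close> of it, takes a value in
  \<open>[h1, h2]\<close>.  The margin \<open>2 L\<close> covers the mollified Hamiltonian uniformly in \<open>e \<le> 1\<close>.\<close>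

definition level_radius :: "real \<Rightarrow> real \<Rightarrow> real" where
  "level_radius h1 h2 = (\<bar>h1\<bar> + \<bar>h2\<bar> + 2 * L + (\<bar>H (0, 0)\<bar> + L * T)) / m"

lemma abs_le_level_radius:
  assumes "t \<in> {0..T}" "\<bar>H (t, x) - h\<bar> \<le> 2 * L" "h \<in> {h1..h2}"
  shows "\<bar>x\<bar> \<le> level_radius h1 h2"
proof -
  have "m * \<bar>x\<bar> \<le> \<bar>h1\<bar> + \<bar>h2\<bar> + 2 * L + (\<bar>H (0, 0)\<bar> + L * T)"
    using H_coercive[OF assms(1), of x] assms(2,3) by auto
  then show ?thesis using m by (simp add: level_radius_def field_simps)
qed

lemma level_function_support:
  assumes a: "0 < a" "a' < T"
    and f: "\<And>t. t \<notin> {a..a'} \<Longrightarrow> f t = (0 :: real)" and g: "\<And>h. h \<notin> {h1..h2} \<Longrightarrow> g h = (0 :: real)"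
    and p: "p \<notin> {a..a'} \<times> {- level_radius h1 h2..level_radius h1 h2}"
  shows "f (fst p) * g (H_ext p) = 0"
proof (cases "fst p \<in> {a..a'}")
  case True
  obtain t x where tx: "p = (t, x)" by (cases p)
  have t: "0 < t" "t < T" "t \<in> {a..a'}" using True a tx by auto
  have "H (t, x) \<notin> {h1..h2}"
    using abs_le_level_radius[of t x "H (t, x)" h1 h2] t p L_nonneg tx by (auto simp: abs_le_iff)
  then show ?thesis using g t by (simp add: tx H_ext_eq)
qed (use f in simp)

lemma level_function_integrable:
  assumes a: "0 < a" "a' < T" and \<rho>: "locally_bounded_borel \<rho>"
    and f: "continuous_on UNIV f" "\<And>t. t \<notin> {a..a'} \<Longrightarrow> f t = 0"
    and g: "continuous_on UNIV g" "\<And>h. h \<notin> {h1..h2} \<Longrightarrow> g h = 0"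
  shows "integrable lborel (\<lambda>p. \<rho> p * (f (fst p) * g (H_ext p)))"
proof -
  obtain Bf where Bf: "0 \<le> Bf" "\<And>x. \<bar>f x\<bar> \<le> Bf"
    using continuous_compact_support_bounded[OF f] by metis
  obtain Bg where Bg: "0 \<le> Bg" "\<And>x. \<bar>g x\<bar> \<le> Bg"
    using continuous_compact_support_bounded[OF g] by metis
  have meas: "f \<in> borel_measurable borel" "g \<in> borel_measurable borel" "H_ext \<in> borel_measurable borel"
    using f(1) g(1) H_ext_locally_bounded by (auto simp: locally_bounded_borel_def intro: borel_measurable_continuous_onI)
  let ?K = "{a..a'} \<times> {- level_radius h1 h2..level_radius h1 h2}"
  have "bounded ?K" by (intro bounded_Times) auto
  then obtain R where R: "\<And>p. p \<in> ?K \<Longrightarrow> norm p \<le> R"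
    unfolding bounded_iff by blast
  show ?thesis
  proof (rule locally_bounded_borel_integrable[OF \<rho>, where R = R and B = "Bf * Bg"])
    show "\<bar>f (fst p) * g (H_ext p)\<bar> \<le> Bf * Bg" for p
      unfolding abs_mult using Bf Bg by (intro mult_mono) auto
    show "R < norm p \<Longrightarrow> f (fst p) * g (H_ext p) = 0" for p
      using R[of p] by (intro level_function_support[OF a f(2) g(2)]) auto
  next
    have fst: "fst \<in> borel_measurable (borel :: (real \<times> real) measure)"
      by (intro borel_measurable_continuous_onI continuous_on_fst continuous_on_id)
    show "(\<lambda>p. f (fst p) * g (H_ext p)) \<in> borel_measurable borel"
      by (rule borel_measurable_times[OF measurable_compose[OF fst meas(1)] measurable_compose[OF meas(3,2)]])
  qed
qed

text \<open>The central identity: every density \<open>\<rho>\<close> of \<open>b\<close>, in particular one different from \<open>r\<close>, is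
  transported along the level lines of \<open>H\<close>.  The test function is \<open>\<theta> (t) \<psi> (H\<^sub>e (t, x))\<close>.  The
  difference \<open>E\<close> between the desired integrand and the tested one consists of two small parts: the
  replacement of \<open>H\<close> by \<open>H\<^sub>e\<close> inside \<open>\<psi>\<close>, of size \<open>e\<close>, and the commutator
  \<open>b (r * \<eta>\<^sub>e - r) - ((r b) * \<eta>\<^sub>e - r b)\<close>, small in \<open>L\<^sup>1\<close>.\<close>

lemma transported_integral_zero:
  assumes \<rho>: "\<rho> \<in> borel_measurable borel" "\<And>p. p \<notin> spacetime T \<Longrightarrow> \<rho> p = 0" "\<And>p. \<bar>\<rho> p\<bar> \<le> N"
    and div: "\<And>\<phi>. \<phi> \<in> test_functions (spacetime T) \<Longrightarrow>
       (\<integral>p. \<rho> p * partial_t \<phi> p \<partial>lborel) + (\<integral>p. (\<rho> p * b p) * partial_x \<phi> p \<partial>lborel) = 0"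
    and a: "0 < a" "a' < T"
    and \<theta>: "smooth1 \<theta>" "\<And>t. (\<theta> has_real_derivative \<theta>' t) (at t)" "\<And>t. t \<notin> {a..a'} \<Longrightarrow> \<theta> t = 0"
    and \<psi>: "smooth1 \<psi>" "\<And>h. h \<notin> {h1..h2} \<Longrightarrow> \<psi> h = 0"
  shows "(\<integral>p. \<rho> p * (\<theta>' (fst p) * \<psi> (H_ext p)) \<partial>lborel) = 0"
proof (rule dense_eq0_I)
  fix \<epsilon> :: real assume \<epsilon>: "0 < \<epsilon>"
  obtain \<psi>' where \<psi>': "\<And>h. (\<psi> has_real_derivative \<psi>' h) (at h)" "smooth1 \<psi>'"
    using smooth1_has_derivative[OF \<psi>(1)] by blast
  have \<theta>': "smooth1 \<theta>'" by (rule smooth1_derivative[OF \<theta>(1,2)])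
  have \<theta>'_zero: "\<And>t. t \<notin> {a..a'} \<Longrightarrow> \<theta>' t = 0" and \<psi>'_zero: "\<And>h. h \<notin> {h1..h2} \<Longrightarrow> \<psi>' h = 0"
    using derivative_support[OF \<theta>(2,3)] derivative_support[OF \<psi>'(1) \<psi>(2)] by blast+
  obtain B1 where B1: "0 \<le> B1" "\<And>t. \<bar>\<theta> t\<bar> \<le> B1"
    using continuous_compact_support_bounded[OF smooth1_continuous[OF \<theta>(1)] \<theta>(3)] by metis
  obtain B2 where B2: "0 \<le> B2" "\<And>t. \<bar>\<theta>' t\<bar> \<le> B2"
    using continuous_compact_support_bounded[OF smooth1_continuous[OF \<theta>'] \<theta>'_zero] by metis
  obtain B3 where B3: "0 \<le> B3" "\<And>h. \<bar>\<psi>' h\<bar> \<le> B3"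
    using continuous_compact_support_bounded[OF smooth1_continuous[OF \<psi>'(2)] \<psi>'_zero] by metis
  have N: "0 \<le> N" using \<rho>(3)[of undefined] by linarith
  have \<rho>_lb: "locally_bounded_borel \<rho>" and \<rho>b_lb: "locally_bounded_borel (\<lambda>p. \<rho> p * b p)"
  proof -
    show "locally_bounded_borel \<rho>" by (rule locally_bounded_borelI[OF \<rho>(1,3)])
    have "\<bar>\<rho> p * b p\<bar> \<le> N * C" for p
      unfolding abs_mult using \<rho>(3)[of p] b_bound[of p] by (intro mult_mono) auto
    moreover have "(\<lambda>p. \<rho> p * b p) \<in> borel_measurable borel" using \<rho>(1) by measurable
    ultimately show "locally_bounded_borel (\<lambda>p. \<rho> p * b p)"
      by (intro locally_bounded_borelI[where B = "N * C"]) auto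
  qed
  let ?R = "level_radius h1 h2"
  let ?K = "{a..a'} \<times> {- ?R..?R}"
  have K: "bounded ?K" "?K \<in> sets borel"
    by (auto intro!: bounded_Times borel_closed closed_Times)
  define c0 where "c0 = measure lborel ?K"
  have c0: "0 \<le> c0" "emeasure lborel ?K = ennreal c0"
    using emeasure_bounded_finite[OF K(1)] by (auto simp: c0_def measure_def less_top)
  define c1 c2 where "c1 = N * B2 * B3 * (2 * L)" and "c2 = N * B1 * B3"
  have c12: "0 \<le> c1" "0 \<le> c2" using N B1 B2 B3 L_nonneg by (auto simp: c1_def c2_def)
  define c3 where "c3 = c1 * c0 + c2 * C + c2 + 1"
  \<comment> \<open>The final error is at most \<open>(c1 c0 + c2 C + c2) \<delta>\<close>.\<close>
  define \<delta> where "\<delta> = \<epsilon> / c3"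
  have pos: "0 \<le> c1 * c0" "0 \<le> c2 * C" using c12 c0 C_nonneg by auto
  have \<delta>: "0 < \<delta>" "c1 * c0 * \<delta> + c2 * C * \<delta> + c2 * \<delta> \<le> \<epsilon>"
  proof -
    have "1 \<le> c3" using pos c12(2) by (simp add: c3_def)
    then show "0 < \<delta>" using \<epsilon> by (simp add: \<delta>_def)
    have "c1 * c0 * \<delta> + c2 * C * \<delta> + c2 * \<delta> = (c3 - 1) * \<delta>"
      by (simp add: c3_def algebra_simps)
    also have "\<dots> \<le> c3 * \<delta>" using \<open>0 < \<delta>\<close> by (simp add: algebra_simps)
    finally show "c1 * c0 * \<delta> + c2 * C * \<delta> + c2 * \<delta> \<le> \<epsilon>" using \<open>1 \<le> c3\<close> by (simp add: \<delta>_def)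
  qed
  obtain e1 where e1: "0 < e1" "\<And>e. 0 < e \<Longrightarrow> e < e1 \<Longrightarrow>
      (\<integral>\<^sup>+q. ennreal (indicator ?K q * \<bar>conv r (mollifier e) q - r q\<bar>) \<partial>lborel) \<le> ennreal \<delta>"
    using conv_mollifier_L1[OF r_locally_bounded K \<delta>(1)] by blast
  obtain e2 where e2: "0 < e2" "\<And>e. 0 < e \<Longrightarrow> e < e2 \<Longrightarrow>
      (\<integral>\<^sup>+q. ennreal (indicator ?K q * \<bar>conv flux (mollifier e) q - flux q\<bar>) \<partial>lborel) \<le> ennreal \<delta>"
    using conv_mollifier_L1[OF flux_locally_bounded K \<delta>(1)] by blast
  \<comment> \<open>\<open>e < a\<close> keeps the mollified Hamiltonian meaningful on the support of \<open>\<theta>\<close>; \<open>e \<le> 1\<close> matches the margin in \<open>level_radius\<close>.\<close>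
  define e where "e = min (min e1 e2) (min (min a 1) \<delta>) / 2"
  have e: "0 < e" "e < e1" "e < e2" "e < a" "e \<le> 1" "e \<le> \<delta>"
    using e1(1) e2(1) a \<delta>(1) by (auto simp: e_def min_def)

  have good: "e < t" "t < T" "t \<in> {0..T}" if "t \<in> {a..a'}" for t
    using that a e by auto
  have close: "\<bar>H_moll e (t, x) - H (t, x)\<bar> \<le> 2 * L * e" if "t \<in> {a..a'}" for t x
    using H_moll_close[OF e(1) good(1,2)[OF that]] .
  have far: "H_moll e (t, x) \<notin> {h1..h2}" if "t \<in> {a..a'}" "x \<notin> {- ?R..?R}" for t x
  proof
    assume in_range: "H_moll e (t, x) \<in> {h1..h2}"
    have "\<bar>H (t, x) - H_moll e (t, x)\<bar> \<le> 2 * L * e"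
      using close[OF that(1), of x] by (simp add: abs_minus_commute)
    also have "\<dots> \<le> 2 * L" using e L_nonneg mult_left_mono[of e 1 "2 * L"] by simp
    finally have "\<bar>x\<bar> \<le> ?R" by (rule abs_le_level_radius[OF good(3)[OF that(1)] _ in_range])
    with that(2) show False by auto
  qed

  define \<phi> where "\<phi> p = \<theta> (fst p) * \<psi> (H_moll e p)" for p
  have "\<phi> \<in> test_functions (spacetime T)"
  proof (rule test_functionsI[where K = ?K])
    show "C_times k \<phi>" for k
      unfolding \<phi>_def by (intro C_times_mult C_times_compose[OF \<theta>(1)] C_times_compose[OF \<psi>(1)] C_times_fst H_moll_smooth e)
    show "compact ?K" by (intro compact_Times) auto
    show "?K \<subseteq> spacetime T" using a by (auto simp: mem_spacetime)
    show "\<phi> p = 0" if "p \<notin> ?K" for p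
      using that far[of "fst p" "snd p"] \<theta>(3)[of "fst p"] \<psi>(2)[of "H_moll e p"]
      by (cases p) (auto simp: \<phi>_def)
  qed
  note test = this
  note D = C_times_SucD(1,2)[OF H_moll_smooth[OF e(1), of "Suc 0"]]
  have \<phi>t: "partial_t \<phi> p = \<theta>' (fst p) * \<psi> (H_moll e p) + \<theta> (fst p) * (\<psi>' (H_moll e p) * partial_t (H_moll e) p)" for p
  proof (cases p)
    case (Pair t x)
    have "((\<lambda>s. \<phi> (s, x)) has_real_derivative
      \<theta> t * (\<psi>' (H_moll e (t, x)) * partial_t (H_moll e) (t, x)) + \<theta>' t * \<psi> (H_moll e (t, x))) (at t)"
      using DERIV_mult'[OF \<theta>(2) DERIV_chain2[OF \<psi>'(1) D(1)]] by (simp add: \<phi>_def)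
    from DERIV_imp_deriv[OF this] show ?thesis
      by (simp add: partial_t_def[of \<phi>] Pair)
  qed
  have \<phi>x: "partial_x \<phi> p = \<theta> (fst p) * (\<psi>' (H_moll e p) * partial_x (H_moll e) p)" for p
  proof (cases p)
    case (Pair t x)
    have "((\<lambda>y. \<phi> (t, y)) has_real_derivative \<theta> t * (\<psi>' (H_moll e (t, x)) * partial_x (H_moll e) (t, x))) (at x)"
      using DERIV_cmult[OF DERIV_chain2[OF \<psi>'(1) D(2)]] by (simp add: \<phi>_def)
    from DERIV_imp_deriv[OF this] show ?thesis
      by (simp add: partial_x_def[of \<phi>] Pair)
  qed
  define E where "E p = \<rho> p * (\<theta>' (fst p) * \<psi> (H_ext p)) - (\<rho> p * partial_t \<phi> p + (\<rho> p * b p) * partial_x \<phi> p)" for p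
  have E: "E p = \<rho> p * (\<theta>' (fst p) * (\<psi> (H_ext p) - \<psi> (H_moll e p))
      - \<theta> (fst p) * \<psi>' (H_moll e p) * (partial_t (H_moll e) p + b p * partial_x (H_moll e) p))" for p
    by (simp add: E_def \<phi>t \<phi>x algebra_simps)
  have bound: "\<bar>E p\<bar> \<le> c1 * e + c2 * C * \<bar>conv r (mollifier e) p - r p\<bar> + c2 * \<bar>conv flux (mollifier e) p - flux p\<bar>"
    if "p \<in> ?K" for p
  proof -
    obtain t x where p: "p = (t, x)" by (cases p)
    have t: "t \<in> {a..a'}" using that p by auto
    have "\<bar>\<psi> (H_ext p) - \<psi> (H_moll e p)\<bar> \<le> B3 * \<bar>H_ext p - H_moll e p\<bar>"
      using field_differentiable_bound[of UNIV \<psi> \<psi>' B3 "H_ext p" "H_moll e p"] \<psi>'(1) B3(2) by auto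
    also have "\<dots> \<le> B3 * (2 * L * e)"
      using close[OF t, of x] t a B3(1) by (intro mult_left_mono) (auto simp: p H_ext_eq abs_minus_commute)
    finally have 1: "\<bar>\<theta>' (fst p) * (\<psi> (H_ext p) - \<psi> (H_moll e p))\<bar> \<le> B2 * (B3 * (2 * L * e))"
      unfolding abs_mult by (intro mult_mono B2) auto
    have "partial_t (H_moll e) p + b p * partial_x (H_moll e) p
        = b p * (conv r (mollifier e) p - r p) - (conv flux (mollifier e) p - flux p)"
      unfolding p H_moll_partial[OF e(1) good(1,2)[OF t]] by (simp add: flux_def algebra_simps)
    also have "\<bar>\<dots>\<bar> \<le> C * \<bar>conv r (mollifier e) p - r p\<bar> + \<bar>conv flux (mollifier e) p - flux p\<bar>" (is "_ \<le> ?d")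
      unfolding abs_mult[symmetric]
      by (rule order_trans[OF abs_triangle_ineq4]) (use b_bound[of p] in \<open>simp add: abs_mult mult_right_mono\<close>)
    finally have 2: "\<bar>\<theta> (fst p) * \<psi>' (H_moll e p) * (partial_t (H_moll e) p + b p * partial_x (H_moll e) p)\<bar> \<le> (B1 * B3) * ?d"
      unfolding abs_mult by (intro mult_mono B1 B3) (auto simp: B1 B3 C_nonneg)
    have "\<bar>E p\<bar> \<le> N * (B2 * (B3 * (2 * L * e)) + (B1 * B3) * ?d)"
      unfolding E abs_mult[of "\<rho> p"]
      by (intro mult_mono \<rho>(3) N order_trans[OF abs_triangle_ineq4] add_mono 1 2) auto
    then show ?thesis by (simp add: c1_def c2_def algebra_simps)
  qed
  have zero: "E p = 0" if "p \<notin> ?K" for p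
  proof (cases "fst p \<in> {a..a'}")
    case True
    then have "snd p \<notin> {- ?R..?R}" using that by (simp add: mem_Times_iff)
    from far[OF True this] have "H_moll e p \<notin> {h1..h2}" by simp
    then have "\<psi> (H_moll e p) = 0" "\<psi>' (H_moll e p) = 0" by (simp_all add: \<psi>(2) \<psi>'_zero)
    moreover have "\<theta>' (fst p) * \<psi> (H_ext p) = 0"
      by (rule level_function_support[OF a \<theta>'_zero \<psi>(2) that])
    ultimately show ?thesis by (simp add: E)
  qed (simp add: E \<theta>(3) \<theta>'_zero)
  have int: "integrable lborel (\<lambda>p. \<rho> p * (\<theta>' (fst p) * \<psi> (H_ext p)))"
    by (rule level_function_integrable[OF a \<rho>_lb smooth1_continuous[OF \<theta>'] \<theta>'_zero smooth1_continuous[OF \<psi>(1)] \<psi>(2)])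
  note int2 = test_functions_integrable[OF \<rho>_lb test_functions_partial(1)[OF test]]
    test_functions_integrable[OF \<rho>b_lb test_functions_partial(2)[OF test]]
  have intE: "integrable lborel E"
    unfolding E_def[abs_def] by (intro Bochner_Integration.integrable_diff Bochner_Integration.integrable_add int int2)
  have "(\<integral>p. \<rho> p * (\<theta>' (fst p) * \<psi> (H_ext p)) \<partial>lborel) = (\<integral>p. E p \<partial>lborel)"
    unfolding E_def using div[OF test] int int2 by simp
  then have "ennreal \<bar>\<integral>p. \<rho> p * (\<theta>' (fst p) * \<psi> (H_ext p)) \<partial>lborel\<bar> \<le> (\<integral>\<^sup>+p. ennreal \<bar>E p\<bar> \<partial>lborel)"
    using integral_norm_bound_ennreal[OF intE] by simp
  also have "\<dots> \<le> (\<integral>\<^sup>+p. ennreal (c1 * e) * indicator ?K p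
       + (ennreal (c2 * C) * ennreal (indicator ?K p * \<bar>conv r (mollifier e) p - r p\<bar>)
       + ennreal c2 * ennreal (indicator ?K p * \<bar>conv flux (mollifier e) p - flux p\<bar>)) \<partial>lborel)"
  proof (rule nn_integral_mono)
    fix p
    show "ennreal \<bar>E p\<bar> \<le> ennreal (c1 * e) * indicator ?K p
       + (ennreal (c2 * C) * ennreal (indicator ?K p * \<bar>conv r (mollifier e) p - r p\<bar>)
       + ennreal c2 * ennreal (indicator ?K p * \<bar>conv flux (mollifier e) p - flux p\<bar>))"
    proof (cases "p \<in> ?K")
      case True
      then show ?thesis
        using bound[OF True] c12 pos e(1)
        by (simp add: ennreal_mult[symmetric] ennreal_leI add.assoc del: mem_Times_iff flip: ennreal_plus)
    qed (simp add: zero)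
  qed
  also have "\<dots> = ennreal (c1 * e) * emeasure lborel ?K
     + (ennreal (c2 * C) * (\<integral>\<^sup>+p. ennreal (indicator ?K p * \<bar>conv r (mollifier e) p - r p\<bar>) \<partial>lborel)
     + ennreal c2 * (\<integral>\<^sup>+p. ennreal (indicator ?K p * \<bar>conv flux (mollifier e) p - flux p\<bar>) \<partial>lborel))"
  proof -
    have [measurable]: "conv r (mollifier e) \<in> borel_measurable borel" "conv flux (mollifier e) \<in> borel_measurable borel"
      "flux \<in> borel_measurable borel" "(indicator ?K :: _ \<Rightarrow> real) \<in> borel_measurable borel"
      "(indicator ?K :: _ \<Rightarrow> ennreal) \<in> borel_measurable borel"
      using flux_locally_bounded r_locally_bounded K(2)
      by (auto simp: locally_bounded_borel_def intro!: borel_measurable_indicator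
          borel_measurable_continuous_onI conv_continuous[OF _ mollifier_test_function[OF e(1)]])
    show ?thesis
      using K(2) by (simp add: nn_integral_add nn_integral_cmult nn_integral_cmult_indicator)
  qed
  also have "\<dots> \<le> ennreal (c1 * \<delta>) * ennreal c0 + (ennreal (c2 * C) * ennreal \<delta> + ennreal c2 * ennreal \<delta>)"
    unfolding c0(2) using e c12
    by (intro add_mono mult_mono e1(2) e2(2) ennreal_leI mult_left_mono order_refl) auto
  also have "\<dots> = ennreal (c1 * c0 * \<delta> + c2 * C * \<delta> + c2 * \<delta>)"
    using c12 c0(1) \<delta>(1) pos C_nonneg by (simp add: ennreal_mult[symmetric] ac_simps flip: ennreal_plus)
  also have "\<dots> \<le> ennreal \<epsilon>" using \<delta>(2) by (rule ennreal_leI)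
  finally show "\<bar>\<integral>p. \<rho> p * (\<theta>' (fst p) * \<psi> (H_ext p)) \<partial>lborel\<bar> \<le> \<epsilon>"
    using \<epsilon> by (simp add: ennreal_le_iff)
qed

section \<open>The flow does not expand distances\<close>

text \<open>A pulse in time has mass one, so a region of constant width in space contributes that width.
  Negative widths and weights are covered since \<open>ennreal\<close> truncates them to \<open>0\<close>.\<close>

lemma nn_integral_pulse_box:
  assumes "c \<noteq> 0"
  shows "(\<integral>\<^sup>+p. ennreal (k * (pulse (c * fst p + d) * \<bar>c\<bar> * indicator {u..v} (snd p))) \<partial>lborel)
    = ennreal k * ennreal (v - u)"
proof (cases "0 \<le> k")
  case True
  have "(\<integral>\<^sup>+p. ennreal (pulse (d + c * fst p) * \<bar>c\<bar> * indicator {u..v} (snd p)) \<partial>lborel)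
    = 1 * (\<integral>\<^sup>+x. ennreal (indicator {u..v} x) \<partial>lborel)"
    using nn_integral_pulse_affine[OF assms, of d]
    by (subst nn_integral_tensor[where f = "\<lambda>s. pulse (d + c * s) * \<bar>c\<bar>"]) (auto simp: pulse_nonneg)
  also have "(\<integral>\<^sup>+x. ennreal (indicator {u..v} x) \<partial>lborel) = ennreal (v - u)"
    by (simp add: ennreal_indicator emeasure_lborel_Icc_eq ennreal_neg)
  finally have *: "(\<integral>\<^sup>+p. ennreal (pulse (d + c * fst p) * \<bar>c\<bar> * indicator {u..v} (snd p)) \<partial>lborel) = ennreal (v - u)"
    by simp
  have "(\<lambda>p :: real \<times> real. pulse (d + c * fst p) * \<bar>c\<bar> * indicator {u..v} (snd p)) \<in> borel_measurable (lborel \<Otimes>\<^sub>M lborel)"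
    by measurable
  then have "(\<integral>\<^sup>+p. ennreal k * ennreal (pulse (d + c * fst p) * \<bar>c\<bar> * indicator {u..v} (snd p)) \<partial>lborel) = ennreal k * ennreal (v - u)"
    unfolding lborel_prod by (subst nn_integral_cmult) (simp_all add: *)
  then show ?thesis
    using True by (simp add: ennreal_mult pulse_nonneg add.commute)
next
  case False
  then have "ennreal (k * (pulse (c * fst p + d) * \<bar>c\<bar> * indicator {u..v} (snd p))) = 0" for p
    by (intro ennreal_neg mult_nonpos_nonneg) (auto simp: pulse_nonneg)
  with False show ?thesis by (simp add: ennreal_neg)
qed

text \<open>The conserved mass is compared at two times, \<open>d\<close> and \<open>t\<close>, each smeared over an interval of length
  \<open>d\<close>.  The level cutoff \<open>\<psi>\<close> is \<open>1\<close> between the level lines through \<open>x1\<close> and \<open>x2\<close> and vanishes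
  outside those through \<open>x1 - d\<close> and \<open>x2 + d\<close>.  Hence the mass near time \<open>t\<close> is at least \<open>C1\<close>
  times the distance of the inner lines, and the mass near time \<open>d\<close> is at most \<open>C2\<close> times the
  distance of the outer ones.  Since level lines have slope at most \<open>C\<close>, the smearing costs \<open>C d\<close>
  per line near time \<open>t\<close>, and \<open>2 C d\<close> per line for times in \<open>[d, 2 d]\<close> relative to the initial
  positions.\<close>

lemma flow_expansion_approximate:
  assumes \<rho>: "\<rho> \<in> borel_measurable borel" "\<And>p. p \<notin> spacetime T \<Longrightarrow> \<rho> p = 0"
    and \<rho>_bounds: "0 < C1" "\<And>p. p \<in> spacetime T \<Longrightarrow> C1 \<le> \<rho> p" "\<And>p. p \<in> spacetime T \<Longrightarrow> \<rho> p \<le> C2"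
    and div: "\<And>\<phi>. \<phi> \<in> test_functions (spacetime T) \<Longrightarrow>
       (\<integral>p. \<rho> p * partial_t \<phi> p \<partial>lborel) + (\<integral>p. (\<rho> p * b p) * partial_x \<phi> p \<partial>lborel) = 0"
    and d: "0 < d" "2 * d < t" "t + d < T" and x: "x1 < x2"
  shows "C1 * (flow t x2 - flow t x1 - 2 * C * d) \<le> C2 * (x2 - x1 + 2 * d + 4 * C * d)"
proof -
  have C2: "0 \<le> C2"
    using \<rho>_bounds(1) \<rho>_bounds(2,3)[of "(t, 0)"] d by (auto simp: mem_spacetime)
  have \<rho>_nonneg: "0 \<le> \<rho> p" and \<rho>_le: "\<rho> p \<le> C2" for p
    using \<rho>(2)[of p] \<rho>_bounds(1) \<rho>_bounds(2,3)[of p] C2 by (cases "p \<in> spacetime T"; force)+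
  define h1' h1 h2 h2' where "h1' = H (0, x1 - d)" and "h1 = H (0, x1)" and "h2 = H (0, x2)" and "h2' = H (0, x2 + d)"
  have h: "h1' < h1" "h1 < h2" "h2 < h2'"
    using H_le_iff[of 0] d x T by (auto simp: h1'_def h1_def h2_def h2'_def not_le[symmetric])
  define \<psi> where "\<psi> y = step (1 / (h1 - h1') * y + - h1' / (h1 - h1'))
      + - 1 * step (1 / (h2' - h2) * y + - h2 / (h2' - h2))" for y
  have \<psi>_eq: "\<psi> y = step ((y - h1') / (h1 - h1')) - step ((y - h2) / (h2' - h2))" for y
    by (simp add: \<psi>_def diff_divide_distrib)
  have \<psi>_smooth: "smooth1 \<psi>"
    unfolding \<psi>_def[abs_def]
    by (rule smooth1_add[OF smooth1_affine[OF smooth1_step] smooth1_mult[OF smooth1_const smooth1_affine[OF smooth1_step]]])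
  have \<psi>_1: "\<psi> y = 1" if "y \<in> {h1..h2}" for y
    using that h by (simp add: \<psi>_eq step_eq_1 step_eq_0 divide_nonpos_pos)
  have \<psi>_0: "\<psi> y = 0" if "y \<notin> {h1'..h2'}" for y
  proof (cases "y < h1'")
    case True
    then show ?thesis using h by (simp add: \<psi>_eq step_eq_0 divide_nonpos_pos)
  next
    case False
    then have "h2' \<le> y" using that by auto
    then show ?thesis using h by (simp add: \<psi>_eq step_eq_1)
  qed
  have \<psi>_bounds: "0 \<le> \<psi> y" "\<psi> y \<le> 1" for y
  proof -
    show "\<psi> y \<le> 1" using step_bounds by (simp add: \<psi>_eq add_increasing2 diff_le_eq)
    show "0 \<le> \<psi> y"
    proof (cases "h1 \<le> y")
      case True
      then have "step ((y - h1') / (h1 - h1')) = 1" using h by (simp add: step_eq_1)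
      then show ?thesis using step_bounds by (simp add: \<psi>_eq)
    next
      case False
      then have "step ((y - h2) / (h2' - h2)) = 0" using h by (intro step_eq_0 divide_nonpos_pos) auto
      then show ?thesis using step_bounds by (simp add: \<psi>_eq)
    qed
  qed

  define q where "q s \<tau> = pulse (1 / d * \<tau> + - s / d) * (1 / d)" for s \<tau>
  define \<theta> where "\<theta> \<tau> = step (1 / d * \<tau> + - d / d) + - 1 * step (1 / d * \<tau> + - t / d)" for \<tau>
  have q_smooth: "smooth1 (q s)" for s
    unfolding q_def[abs_def] by (rule smooth1_mult[OF smooth1_affine[OF smooth1_pulse] smooth1_const])
  have q_nonneg: "0 \<le> q s \<tau>" for s \<tau>
    using d by (simp add: q_def pulse_nonneg)
  have q_0: "q s \<tau> = 0" if "\<tau> \<notin> {s..s + d}" for s \<tau>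
  proof -
    have "(\<tau> - s) / d \<le> 0 \<or> 1 \<le> (\<tau> - s) / d" using that d by (auto simp: field_simps)
    then show ?thesis by (simp add: q_def pulse_eq_0 diff_divide_distrib)
  qed
  have \<theta>_smooth: "smooth1 \<theta>"
    unfolding \<theta>_def[abs_def]
    by (rule smooth1_add[OF smooth1_affine[OF smooth1_step] smooth1_mult[OF smooth1_const smooth1_affine[OF smooth1_step]]])
  have \<theta>_deriv: "(\<theta> has_real_derivative q d \<tau> - q t \<tau>) (at \<tau>)" for \<tau>
    unfolding \<theta>_def[abs_def] q_def
    by (auto intro!: derivative_eq_intros DERIV_chain2[OF step_has_derivative])
  have \<theta>_0: "\<theta> \<tau> = 0" if "\<tau> \<notin> {d..t + d}" for \<tau>
  proof -
    have eq: "\<theta> \<tau> = step ((\<tau> - d) / d) - step ((\<tau> - t) / d)"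
      by (simp add: \<theta>_def diff_divide_distrib)
    show ?thesis
    proof (cases "\<tau> < d")
      case True
      then show ?thesis using d unfolding eq by (simp add: step_eq_0 divide_nonpos_pos)
    next
      case False
      then have "t + d \<le> \<tau>" using that by auto
      then show ?thesis using d unfolding eq by (simp add: step_eq_1)
    qed
  qed

  have \<rho>_lb: "locally_bounded_borel \<rho>"
    using \<rho>_nonneg \<rho>_le by (intro locally_bounded_borelI[OF \<rho>(1), of C2]) (auto simp: abs_of_nonneg)
  let ?G = "\<lambda>s p. \<rho> p * (q s (fst p) * \<psi> (H_ext p))"
  have G_int: "integrable lborel (?G s)" if s: "0 < s" "s + d < T" for s
    by (rule level_function_integrable[OF s \<rho>_lb smooth1_continuous[OF q_smooth] q_0 smooth1_continuous[OF \<psi>_smooth] \<psi>_0])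
  have G_nonneg: "0 \<le> ?G s p" for s p
    by (intro mult_nonneg_nonneg \<rho>_nonneg q_nonneg \<psi>_bounds)
  have "(\<integral>p. \<rho> p * ((q d (fst p) - q t (fst p)) * \<psi> (H_ext p)) \<partial>lborel) = 0"
    by (rule transported_integral_zero[OF \<rho> _ div _ _ \<theta>_smooth \<theta>_deriv \<theta>_0 \<psi>_smooth \<psi>_0, where N = C2])
      (use d \<rho>_nonneg \<rho>_le in \<open>auto simp: abs_of_nonneg\<close>)
  then have "(\<integral>p. ?G d p - ?G t p \<partial>lborel) = 0"
    by (simp add: algebra_simps)
  then have "(\<integral>p. ?G d p \<partial>lborel) = (\<integral>p. ?G t p \<partial>lborel)"
    using G_int[of d] G_int[of t] d by (simp add: Bochner_Integration.integral_diff)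
  then have mass: "(\<integral>\<^sup>+p. ennreal (?G d p) \<partial>lborel) = (\<integral>\<^sup>+p. ennreal (?G t p) \<partial>lborel)"
    using G_int[of d] G_int[of t] d G_nonneg by (simp add: nn_integral_eq_integral)

  have inv: "1 / d \<noteq> 0" using d by simp
  have "ennreal C1 * ennreal ((flow t x2 - C * d) - (flow t x1 + C * d))
     = (\<integral>\<^sup>+p. ennreal (C1 * (pulse (1 / d * fst p + - t / d) * \<bar>1 / d\<bar>
         * indicator {flow t x1 + C * d..flow t x2 - C * d} (snd p))) \<partial>lborel)"
    by (rule nn_integral_pulse_box[OF inv, symmetric])
  also have "\<dots> \<le> (\<integral>\<^sup>+p. ennreal (?G t p) \<partial>lborel)"
  proof (intro nn_integral_mono ennreal_leI)
    fix p :: "real \<times> real"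
    obtain \<tau> y where p: "p = (\<tau>, y)" by (cases p)
    have "C1 * (q t \<tau> * indicator {flow t x1 + C * d..flow t x2 - C * d} y) \<le> \<rho> p * (q t \<tau> * \<psi> (H_ext p))"
    proof (cases "\<tau> \<in> {t..t + d} \<and> y \<in> {flow t x1 + C * d..flow t x2 - C * d}")
      case True
      then have \<tau>: "\<tau> \<in> {0..T}" "0 < \<tau>" "\<tau> < T" using d by auto
      have "C * \<bar>\<tau> - t\<bar> \<le> C * d" using True C_nonneg by (intro mult_left_mono) auto
      then have "flow \<tau> x1 \<le> y" "y \<le> flow \<tau> x2"
        using flow_time_lipschitz[of t \<tau> x1] flow_time_lipschitz[of t \<tau> x2] True \<tau> d by auto
      then have "H (\<tau>, y) \<in> {h1..h2}"
        using H_le_iff[OF \<tau>(1)] H_flow[OF \<tau>(1)] by (auto simp: h1_def h2_def simp flip: H_flow[OF \<tau>(1)])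
      then have "\<psi> (H_ext p) = 1" using \<tau> by (simp add: p H_ext_eq \<psi>_1)
      moreover have "C1 \<le> \<rho> p" using \<tau> by (intro \<rho>_bounds) (simp add: p mem_spacetime)
      ultimately show ?thesis using True q_nonneg[of t \<tau>] by (simp add: mult_right_mono)
    next
      case False
      then have "q t \<tau> * indicator {flow t x1 + C * d..flow t x2 - C * d} y = 0"
        using q_0[of \<tau> t] by (auto simp: indicator_def)
      then have "C1 * (q t \<tau> * indicator {flow t x1 + C * d..flow t x2 - C * d} y) = 0"
        by (simp only: mult_zero_right)
      then show ?thesis using G_nonneg[of p t] by (simp only: p fst_conv)
    qed
    then show "C1 * (pulse (1 / d * fst p + - t / d) * \<bar>1 / d\<bar>
         * indicator {flow t x1 + C * d..flow t x2 - C * d} (snd p)) \<le> ?G t p"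
      using d by (simp add: p q_def)
  qed
  also have "\<dots> = (\<integral>\<^sup>+p. ennreal (?G d p) \<partial>lborel)" by (rule mass[symmetric])
  also have "\<dots> \<le> (\<integral>\<^sup>+p. ennreal (C2 * (pulse (1 / d * fst p + - d / d) * \<bar>1 / d\<bar>
         * indicator {x1 - d - C * (2 * d)..x2 + d + C * (2 * d)} (snd p))) \<partial>lborel)"
  proof (intro nn_integral_mono ennreal_leI)
    fix p :: "real \<times> real"
    obtain \<tau> y where p: "p = (\<tau>, y)" by (cases p)
    have "\<rho> p * (q d \<tau> * \<psi> (H_ext p)) \<le> C2 * (q d \<tau> * indicator {x1 - d - C * (2 * d)..x2 + d + C * (2 * d)} y)"
    proof (cases "q d \<tau> = 0 \<or> \<psi> (H_ext p) = 0")
      case True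
      then show ?thesis using C2 q_nonneg[of d \<tau>] by (auto simp: indicator_def)
    next
      case False
      then have \<tau>d: "\<tau> \<in> {d..d + d}" using q_0[of \<tau> d] by auto
      then have \<tau>: "\<tau> \<in> {0..T}" "0 < \<tau>" "\<tau> < T" using d by auto
      have "H (\<tau>, y) \<in> {h1'..h2'}" using False \<psi>_0[of "H_ext p"] \<tau> by (auto simp: p H_ext_eq)
      then have y: "flow \<tau> (x1 - d) \<le> y" "y \<le> flow \<tau> (x2 + d)"
        using H_le_iff[OF \<tau>(1)] by (auto simp: h1'_def h2'_def simp flip: H_flow[OF \<tau>(1)])
      have "C * \<bar>\<tau> - 0\<bar> \<le> C * (2 * d)" using \<tau>d C_nonneg by (intro mult_left_mono) auto
      then have "x1 - d - C * (2 * d) \<le> flow \<tau> (x1 - d)" "flow \<tau> (x2 + d) \<le> x2 + d + C * (2 * d)"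
        using flow_time_lipschitz[of 0 \<tau> "x1 - d"] flow_time_lipschitz[of 0 \<tau> "x2 + d"] \<tau> T
        by (auto simp: flow_0)
      with y have "y \<in> {x1 - d - C * (2 * d)..x2 + d + C * (2 * d)}" by auto
      then show ?thesis
        using \<rho>_le[of p] \<rho>_nonneg[of p] q_nonneg[of d \<tau>] \<psi>_bounds[of "H_ext p"] C2
        by (auto intro!: mult_mono mult_left_le)
    qed
    then show "?G d p \<le> C2 * (pulse (1 / d * fst p + - d / d) * \<bar>1 / d\<bar>
         * indicator {x1 - d - C * (2 * d)..x2 + d + C * (2 * d)} (snd p))"
      using d by (simp add: p q_def)
  qed
  also have "\<dots> = ennreal C2 * ennreal ((x2 + d + C * (2 * d)) - (x1 - d - C * (2 * d)))"
    by (rule nn_integral_pulse_box[OF inv])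
  finally have le: "ennreal C1 * ennreal ((flow t x2 - C * d) - (flow t x1 + C * d))
     \<le> ennreal C2 * ennreal ((x2 + d + C * (2 * d)) - (x1 - d - C * (2 * d)))" .
  have nn: "0 \<le> (x2 + d + C * (2 * d)) - (x1 - d - C * (2 * d))"
    using x d mult_nonneg_nonneg[OF C_nonneg, of d] by simp
  show ?thesis
  proof (cases "0 \<le> (flow t x2 - C * d) - (flow t x1 + C * d)")
    case True
    have "C1 * ((flow t x2 - C * d) - (flow t x1 + C * d)) \<le> C2 * ((x2 + d + C * (2 * d)) - (x1 - d - C * (2 * d)))"
      using le True nn C2 \<rho>_bounds(1) by (simp add: ennreal_mult[symmetric] del: diff_ge_0_iff_ge)
    then show ?thesis by (simp add: algebra_simps)
  next
    case False
    then have "C1 * (flow t x2 - flow t x1 - 2 * C * d) \<le> 0"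
      using \<rho>_bounds(1) by (intro mult_nonneg_nonpos) auto
    also have "\<dots> \<le> C2 * (x2 - x1 + 2 * d + 4 * C * d)"
      using C2 x d C_nonneg by (intro mult_nonneg_nonneg) auto
    finally show ?thesis .
  qed
qed

lemma flow_expansion:
  assumes \<rho>: "\<rho> \<in> borel_measurable borel" "\<And>p. p \<notin> spacetime T \<Longrightarrow> \<rho> p = 0"
    and \<rho>_bounds: "0 < C1" "\<And>p. p \<in> spacetime T \<Longrightarrow> C1 \<le> \<rho> p" "\<And>p. p \<in> spacetime T \<Longrightarrow> \<rho> p \<le> C2"
    and div: "\<And>\<phi>. \<phi> \<in> test_functions (spacetime T) \<Longrightarrow>
       (\<integral>p. \<rho> p * partial_t \<phi> p \<partial>lborel) + (\<integral>p. (\<rho> p * b p) * partial_x \<phi> p \<partial>lborel) = 0"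
    and t: "0 < t" "t < T"
  shows "\<bar>flow t x2 - flow t x1\<bar> \<le> C2 / C1 * \<bar>x2 - x1\<bar>"
proof -
  have ordered: "\<bar>flow t y2 - flow t y1\<bar> \<le> C2 / C1 * (y2 - y1)" if y: "y1 < y2" for y1 y2
  proof -
    let ?l = "\<lambda>d. C1 * (flow t y2 - flow t y1 - 2 * C * d)" and ?r = "\<lambda>d. C2 * (y2 - y1 + 2 * d + 4 * C * d)"
    have "eventually (\<lambda>d. ?l d \<le> ?r d) (at_right 0)"
      unfolding eventually_at_right_field
    proof (intro exI conjI allI impI)
      show "0 < min (t / 2) (T - t)" using t by simp
      show "?l d \<le> ?r d" if "0 < d" "d < min (t / 2) (T - t)" for d
        by (rule flow_expansion_approximate[OF assms(1-6) _ _ _ y]) (use that in auto)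
    qed
    moreover have "(?l \<longlongrightarrow> ?l 0) (at_right 0)" "(?r \<longlongrightarrow> ?r 0) (at_right 0)"
      by (intro tendsto_intros)+
    ultimately have "?l 0 \<le> ?r 0" by (intro tendsto_le[of "at_right (0 :: real)"]) auto
    then have "flow t y2 - flow t y1 \<le> C2 / C1 * (y2 - y1)"
      using \<rho>_bounds(1) by (simp add: field_simps)
    moreover have "flow t y1 \<le> flow t y2"
      using y t H_le_iff[of t "flow t y1" "flow t y2"] H_le_iff[of 0 y1 y2] T by (simp add: H_flow)
    ultimately show ?thesis by simp
  qed
  show ?thesis
    using ordered[of x1 x2] ordered[of x2 x1]
    by (cases x1 x2 rule: linorder_cases) (auto simp: abs_minus_commute)
qed

end

section \<open>From almost everywhere defined fields to Borel functions\<close>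

lemma spacetime_open: "open (spacetime T)"
  by (simp add: spacetime_def open_Times)

lemma spacetime_sets: "spacetime T \<in> sets borel" "spacetime T \<inter> space lebesgue \<in> sets lebesgue"
  using spacetime_open by (auto intro: borel_open)

text \<open>The domain has positive measure, so bounds that hold almost everywhere hold somewhere.\<close>

lemma AE_bounds_consistent:
  assumes "0 < T" "AE p in lebesgue_on (spacetime T). l \<le> u p \<and> u p \<le> (h :: real)"
  shows "l \<le> h"
proof (rule ccontr)
  assume "\<not> l \<le> h"
  have "AE p in lebesgue_on (spacetime T). False"
    using assms(2) by eventually_elim (use \<open>\<not> l \<le> h\<close> in simp)
  then have "AE p in lebesgue. p \<notin> spacetime T"
    by (subst (asm) AE_restrict_space_iff[OF spacetime_sets(2)]) simp
  then have "negligible (spacetime T)"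
    using spacetime_sets by (simp add: negligible_iff_null_sets AE_iff_null_sets)
  moreover have "(T / 2, 0) \<in> spacetime T" using assms(1) by (simp add: spacetime_def)
  ultimately show False using open_not_negligible[OF spacetime_open] by blast
qed

text \<open>Passing to Borel functions on the whole plane replaces integration over the restricted Lebesgue
  measure by integration over \<open>lborel\<close>, where Tonelli applies; distributions do not see the
  change.\<close>

definition represents :: "real \<Rightarrow> (real \<times> real \<Rightarrow> real) \<Rightarrow> (real \<times> real \<Rightarrow> real) \<Rightarrow> bool" where
  "represents T w u \<longleftrightarrow> w \<in> borel_measurable borel \<and> u \<in> borel_measurable (lebesgue_on (spacetime T)) \<and>
     (\<forall>p. p \<notin> spacetime T \<longrightarrow> w p = 0) \<and> (AE p in lebesgue. p \<in> spacetime T \<longrightarrow> w p = u p)"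

text \<open>Clipping to \<open>[l, h]\<close> turns the bounds almost everywhere into bounds everywhere.\<close>

lemma representative_exists:
  assumes T: "0 < T" and u: "u \<in> borel_measurable (lebesgue_on (spacetime T))"
    and bounds: "AE p in lebesgue_on (spacetime T). l \<le> u p \<and> u p \<le> (h :: real)"
  obtains w where "represents T w u" "\<And>p. p \<in> spacetime T \<Longrightarrow> l \<le> w p" "\<And>p. p \<in> spacetime T \<Longrightarrow> w p \<le> h"
proof -
  have lh: "l \<le> h" by (rule AE_bounds_consistent[OF T bounds])
  have "(\<lambda>p. indicator (spacetime T) p *\<^sub>R u p) \<in> borel_measurable lebesgue"
    using u by (rule iffD1[OF borel_measurable_restrict_space_iff[OF spacetime_sets(2)]])
  then obtain g where g: "g \<in> borel_measurable lborel"
    "AE p in lborel. indicator (spacetime T) p *\<^sub>R u p = g p"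
    using completion_ex_borel_measurable_real by blast
  define w where "w p = indicator (spacetime T) p * max l (min h (g p))" for p
  have "AE p in lebesgue. p \<in> spacetime T \<longrightarrow> l \<le> u p \<and> u p \<le> h"
    using bounds by (subst (asm) AE_restrict_space_iff[OF spacetime_sets(2)])
  moreover have "AE p in lebesgue. indicator (spacetime T) p *\<^sub>R u p = g p"
    using g(2) by (rule AE_completion)
  ultimately have "AE p in lebesgue. p \<in> spacetime T \<longrightarrow> w p = u p"
    by eventually_elim (auto simp: w_def)
  moreover have "w \<in> borel_measurable borel"
    using g(1) spacetime_sets(1)[of T] unfolding w_def[abs_def]
    by (intro borel_measurable_times borel_measurable_max borel_measurable_min borel_measurable_indicator) simp_all
  ultimately have "represents T w u"
    using u by (simp add: represents_def w_def)
  then show thesis using lh by (intro that[of w]) (auto simp: w_def)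
qed

lemma represents_mult:
  assumes "represents T w u" "represents T w' u'"
  shows "represents T (\<lambda>p. w p * w' p) (\<lambda>p. u p * u' p)"
proof -
  have "AE p in lebesgue. p \<in> spacetime T \<longrightarrow> w p = u p" "AE p in lebesgue. p \<in> spacetime T \<longrightarrow> w' p = u' p"
    using assms by (auto simp: represents_def)
  then have "AE p in lebesgue. p \<in> spacetime T \<longrightarrow> w p * w' p = u p * u' p"
    by eventually_elim simp
  then show ?thesis
    using assms unfolding represents_def by (auto intro: borel_measurable_times)
qed

lemma regular_distr_represents:
  assumes w: "represents T w u" and \<phi>: "\<phi> \<in> borel_measurable borel"
  shows "regular_distr (spacetime T) u \<phi> = (\<integral>p. w p * \<phi> p \<partial>lborel)"
proof -
  have wb: "w \<in> borel_measurable borel" and ub: "u \<in> borel_measurable (lebesgue_on (spacetime T))"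
    using w by (auto simp: represents_def)
  have \<phi>l: "\<phi> \<in> borel_measurable lebesgue" and wl: "w \<in> borel_measurable lebesgue"
    using \<phi> wb by (auto intro: measurable_completion)
  have "(\<lambda>p. u p * \<phi> p) \<in> borel_measurable (lebesgue_on (spacetime T))"
    using \<phi>l by (intro borel_measurable_times ub measurable_restrict_space1)
  then have m: "(\<lambda>p. indicator (spacetime T) p *\<^sub>R (u p * \<phi> p)) \<in> borel_measurable lebesgue"
    by (rule iffD1[OF borel_measurable_restrict_space_iff[OF spacetime_sets(2)]])
  have "AE p in lebesgue. p \<in> spacetime T \<longrightarrow> w p = u p"
    using w by (simp add: represents_def)
  then have eq: "AE p in lebesgue. indicator (spacetime T) p *\<^sub>R (u p * \<phi> p) = w p * \<phi> p"
    by eventually_elim (use w in \<open>auto simp: represents_def indicator_def\<close>)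
  have "regular_distr (spacetime T) u \<phi> = (\<integral>p. indicator (spacetime T) p *\<^sub>R (u p * \<phi> p) \<partial>lebesgue)"
    unfolding regular_distr_def by (rule integral_restrict_space[OF spacetime_sets(2)])
  also have "\<dots> = (\<integral>p. w p * \<phi> p \<partial>lebesgue)"
    by (rule integral_cong_AE[OF m borel_measurable_times[OF wl \<phi>l] eq])
  also have "\<dots> = (\<integral>p. w p * \<phi> p \<partial>lborel)"
    using \<phi> wb by (intro integral_completion) simp
  finally show ?thesis .
qed

text \<open>The Hamiltonian behind \<open>X\<close> belongs to some density \<open>\<rho>'\<close> with unknown bounds; the constants come
  from \<open>b\<close> and \<open>\<rho>\<close>, because \<open>\<rho>\<close> too is transported along the level lines of that
  Hamiltonian.\<close>

lemma flow_estimates: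
  assumes T: "0 < T" and C: "0 < C" "AE p in lebesgue_on (spacetime T). \<bar>b p\<bar> \<le> C"
    and ni: "nearly_incompressible T b \<rho>"
    and C12: "0 < C1" "AE p in lebesgue_on (spacetime T). C1 \<le> \<rho> p \<and> \<rho> p \<le> C2"
    and X: "is_flow T b X"
  shows "s \<in> {0..T} \<Longrightarrow> t \<in> {0..T} \<Longrightarrow> \<bar>X (t, x) - X (s, x)\<bar> \<le> C * \<bar>t - s\<bar>"
    and "X (0, x) = x"
    and "0 < t \<Longrightarrow> t < T \<Longrightarrow> \<bar>X (t, x) - X (t, y)\<bar> \<le> C2 / C1 * \<bar>x - y\<bar>"
proof -
  let ?\<Omega> = "spacetime T"
  obtain \<rho>' H where ni': "nearly_incompressible T b \<rho>'" and ham: "hamiltonian T \<rho>' b H"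
    and X_eq: "\<And>t x. t \<in> {0..T} \<Longrightarrow> X (t, x) = level_inverse H t (H (0, x))"
    using X unfolding is_flow_def by blast
  obtain c where c: "0 < c" "AE p in lebesgue_on ?\<Omega>. 1 / c \<le> \<rho>' p \<and> \<rho>' p \<le> c"
    using ni' unfolding nearly_incompressible_def by blast
  obtain L where L: "L-lipschitz_on ({0..T} \<times> UNIV) H"
    using ham unfolding hamiltonian_def by blast
  obtain r where r: "represents T r \<rho>'" "\<And>p. p \<in> ?\<Omega> \<Longrightarrow> 1 / c \<le> r p" "\<And>p. p \<in> ?\<Omega> \<Longrightarrow> r p \<le> c"
    using representative_exists[OF T _ c(2)] ni' unfolding nearly_incompressible_def by blast
  obtain w where w: "represents T w \<rho>" "\<And>p. p \<in> ?\<Omega> \<Longrightarrow> C1 \<le> w p" "\<And>p. p \<in> ?\<Omega> \<Longrightarrow> w p \<le> C2"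
    using representative_exists[OF T _ C12(2)] ni unfolding nearly_incompressible_def by blast
  have "AE p in lebesgue_on ?\<Omega>. - C \<le> b p \<and> b p \<le> C"
    using C(2) by eventually_elim (simp add: abs_le_iff)
  moreover have "b \<in> borel_measurable (lebesgue_on ?\<Omega>)"
    using ni by (simp add: nearly_incompressible_def L_infty_def)
  ultimately obtain v where v: "represents T v b" "\<And>p. p \<in> ?\<Omega> \<Longrightarrow> - C \<le> v p" "\<And>p. p \<in> ?\<Omega> \<Longrightarrow> v p \<le> C"
    using representative_exists[OF T] by blast
  have H: "represents T (\<lambda>p. indicator ?\<Omega> p * H p) H"
  proof -
    have cont: "continuous_on ?\<Omega> H"
      using lipschitz_on_continuous_on[OF L] by (rule continuous_on_subset) (auto simp: spacetime_def)
    show ?thesis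
      using borel_measurable_continuous_on_indicator[OF spacetime_sets(1) cont]
        continuous_imp_measurable_on_sets_lebesgue[OF cont] spacetime_sets[of T]
      by (simp add: represents_def)
  qed
  have test_measurable: "\<phi> \<in> borel_measurable borel" "partial_t \<phi> \<in> borel_measurable borel"
    "partial_x \<phi> \<in> borel_measurable borel" if "\<phi> \<in> test_functions ?\<Omega>" for \<phi>
    using that test_functions_partial[OF that]
    by (auto intro!: borel_measurable_continuous_onI test_functions_continuous)
  interpret hamiltonian_field T L "1 / c" c C H r v
  proof
    show "\<bar>v p\<bar> \<le> C" for p
      using v(2,3)[of p] v(1) C(1)
      by (cases "p \<in> ?\<Omega>") (simp_all add: represents_def abs_le_iff minus_le_iff del: split_paired_All)
    fix \<phi> assume \<phi>: "\<phi> \<in> test_functions ?\<Omega>"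
    note meas = test_measurable[OF \<phi>]
    have "distr_dx (regular_distr ?\<Omega> H) \<phi> = regular_distr ?\<Omega> \<rho>' \<phi>"
      using ham \<phi> unfolding hamiltonian_def by blast
    then show "(\<integral>p. (indicator ?\<Omega> p * H p) * partial_x \<phi> p \<partial>lborel) = - (\<integral>p. r p * \<phi> p \<partial>lborel)"
      using regular_distr_represents[OF H meas(3)] regular_distr_represents[OF r(1) meas(1)]
      by (simp add: distr_dx_def)
    have "distr_dt (regular_distr ?\<Omega> H) \<phi> = regular_distr ?\<Omega> (\<lambda>p. - (\<rho>' p * b p)) \<phi>"
      using ham \<phi> unfolding hamiltonian_def by blast
    also have "\<dots> = - regular_distr ?\<Omega> (\<lambda>p. \<rho>' p * b p) \<phi>"
      by (simp add: regular_distr_def)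
    finally show "(\<integral>p. (indicator ?\<Omega> p * H p) * partial_t \<phi> p \<partial>lborel) = (\<integral>p. (r p * v p) * \<phi> p \<partial>lborel)"
      using regular_distr_represents[OF H meas(2)]
        regular_distr_represents[OF represents_mult[OF r(1) v(1)] meas(1)]
      by (simp add: distr_dt_def)
  qed (use T L c(1) r v(1) in \<open>auto simp: represents_def\<close>)
  have X_flow: "X (t, x) = flow t x" if "t \<in> {0..T}" for t x
    using X_eq[OF that] by (simp add: flow_def)
  have div: "(\<integral>p. w p * partial_t \<phi> p \<partial>lborel) + (\<integral>p. (w p * v p) * partial_x \<phi> p \<partial>lborel) = 0"
    if \<phi>: "\<phi> \<in> test_functions ?\<Omega>" for \<phi>
  proof -
    note meas = test_measurable[OF \<phi>]
    have "distr_dt (regular_distr ?\<Omega> \<rho>) \<phi> + distr_dx (regular_distr ?\<Omega> (\<lambda>p. \<rho> p * b p)) \<phi> = 0"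
      using ni \<phi> unfolding nearly_incompressible_def by blast
    then show ?thesis
      using regular_distr_represents[OF w(1) meas(2)]
        regular_distr_represents[OF represents_mult[OF w(1) v(1)] meas(3)]
      by (simp add: distr_dt_def distr_dx_def)
  qed
  show "\<bar>X (t, x) - X (s, x)\<bar> \<le> C * \<bar>t - s\<bar>" if "s \<in> {0..T}" "t \<in> {0..T}"
    using flow_time_lipschitz[OF that] that by (simp add: X_flow)
  show "X (0, x) = x"
    using T by (simp add: X_flow flow_0)
  show "\<bar>X (t, x) - X (t, y)\<bar> \<le> C2 / C1 * \<bar>x - y\<bar>" if t: "0 < t" "t < T"
  proof -
    have w0: "w \<in> borel_measurable borel" "\<And>p. p \<notin> ?\<Omega> \<Longrightarrow> w p = 0"
      using w(1) by (auto simp: represents_def)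
    show ?thesis
      using flow_expansion[OF w0 C12(1) w(2,3) div t] t by (simp add: X_flow)
  qed
qed

section \<open>Compactness\<close>

theorem mainTheorem6:
  fixes T C C\<^sub>1 C\<^sub>2 :: real
    and b \<rho> X :: "nat \<Rightarrow> real \<times> real \<Rightarrow> real"
    and K :: "(real \<times> real) set"
  assumes "T > 0"
    and "\<And>n. b n \<in> L_infty (spacetime T)"
    and "C > 0"
    and "\<And>n. AE p in lebesgue_on (spacetime T). \<bar>b n p\<bar> \<le> C"
    and "\<And>n. nearly_incompressible T (b n) (\<rho> n)"
    and "C\<^sub>1 > 0" and "C\<^sub>2 > 0"
    and "\<And>n. AE p in lebesgue_on (spacetime T). C\<^sub>1 \<le> \<rho> n p \<and> \<rho> n p \<le> C\<^sub>2"
    and "\<And>n. is_flow T (b n) (X n)"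
    and "compact K" and "K \<subseteq> spacetime T"
  shows "precompact_in_C K X"
proof -
  note estimates = flow_estimates[OF assms(1,3,4,5,6,8,9)]
  define \<Lambda> where "\<Lambda> = C + C\<^sub>2 / C\<^sub>1"
  have \<Lambda>: "0 < \<Lambda>" using assms(3,6,7) by (simp add: \<Lambda>_def add_pos_pos)
  have lipschitz: "\<bar>X n p - X n q\<bar> \<le> \<Lambda> * norm (p - q)" if "p \<in> K" "q \<in> K" for n p q
  proof -
    obtain t x s y where pq: "p = (t, x)" "q = (s, y)" by (cases p, cases q)
    have ts: "0 < t" "t < T" "0 < s" "s < T"
      using that assms(11) by (auto simp: pq spacetime_def)
    have "\<bar>X n (t, x) - X n (s, x)\<bar> \<le> C * \<bar>t - s\<bar>"
      using ts by (intro estimates) auto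
    also have "\<dots> \<le> C * norm (p - q)"
      using assms(3) norm_fst_le[of "t - s" "x - y"] by (simp add: pq)
    finally have 1: "\<bar>X n (t, x) - X n (s, x)\<bar> \<le> C * norm (p - q)" .
    have "\<bar>X n (s, x) - X n (s, y)\<bar> \<le> C\<^sub>2 / C\<^sub>1 * \<bar>x - y\<bar>"
      using ts by (intro estimates) auto
    also have "\<dots> \<le> C\<^sub>2 / C\<^sub>1 * norm (p - q)"
      using assms(6,7) norm_snd_le[of "x - y" "t - s"] by (intro mult_left_mono) (simp_all add: pq)
    finally show ?thesis using 1 by (simp add: pq \<Lambda>_def distrib_right)
  qed
  obtain B where B: "\<And>p. p \<in> K \<Longrightarrow> norm p \<le> B"
    using compact_imp_bounded[OF assms(10)] unfolding bounded_iff by blast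
  have bound: "\<bar>X n p\<bar> \<le> B + C * T" if "p \<in> K" for n p
  proof -
    obtain t x where p: "p = (t, x)" by (cases p)
    have t: "0 < t" "t < T" using that assms(11) by (auto simp: p spacetime_def)
    have "\<bar>X n (t, x) - X n (0, x)\<bar> \<le> C * \<bar>t - 0\<bar>"
      using t by (intro estimates) auto
    also have "\<dots> \<le> C * T" using t assms(3) by simp
    finally have "\<bar>X n (t, x) - x\<bar> \<le> C * T" by (simp add: estimates(2))
    moreover have "\<bar>x\<bar> \<le> B" using B[OF that] norm_snd_le[of x t] by (simp add: p)
    ultimately show ?thesis by (simp add: p)
  qed
  have equicontinuous: "\<exists>d>0. \<forall>n q. q \<in> K \<and> norm (p - q) < d \<longrightarrow> norm (X n p - X n q) < e"
    if "p \<in> K" "0 < e" for p e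
  proof (intro exI[of _ "e / \<Lambda>"] conjI allI impI; (elim conjE)?)
    fix n q assume q: "q \<in> K" "norm (p - q) < e / \<Lambda>"
    have "\<Lambda> * norm (p - q) < e" using q(2) \<Lambda> by (simp add: field_simps)
    with lipschitz[OF that(1) q(1), of n] show "norm (X n p - X n q) < e" by simp
  qed (use that \<Lambda> in simp)
  show ?thesis
    unfolding precompact_in_C_def
  proof (intro conjI allI impI)
    show "continuous_on K (X n)" for n
      using lipschitz[of _ _ n] \<Lambda>
      by (intro lipschitz_on_continuous_on[of \<Lambda>] lipschitz_onI) (auto simp: dist_norm)
    fix r :: "nat \<Rightarrow> nat" assume "strict_mono r"
    have equi: "\<exists>d>0. \<forall>n q. q \<in> K \<and> norm (p - q) < d \<longrightarrow> norm (X (r n) p - X (r n) q) < e"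
      if "p \<in> K" "0 < e" for p e
      using equicontinuous[OF that] by blast
    obtain g s where g: "continuous_on K g" "strict_mono (s :: nat \<Rightarrow> nat)"
      "\<And>e. 0 < e \<Longrightarrow> \<exists>N. \<forall>n x. n \<ge> N \<and> x \<in> K \<longrightarrow> norm (X (r (s n)) x - g x) < e"
    proof (rule Arzela_Ascoli[of K "\<lambda>n. X (r n)" "B + C * T"])
      show "norm (X (r n) p) \<le> B + C * T" if "p \<in> K" for n p
        using bound[OF that] by simp
    qed (use assms(10) equi in blast)+
    have "uniform_limit K (\<lambda>k. X (r (s k))) g sequentially"
      unfolding uniform_limit_iff eventually_sequentially dist_norm using g(3) by blast
    with g show "\<exists>s g. strict_mono s \<and> continuous_on K g \<and> uniform_limit K (\<lambda>k. X (r (s k))) g sequentially"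
      by blast
  qed
qed

end
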